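(* For each $n\ge 4$, the map $\varphi_n:(\mathsf{baxt}_n,{}^{\sharp})\to (UT_{30|I_n|}(\mathbb{S}),{}^{D})$ given by \[ \varphi_n([\mathbf{w}])=\mathsf{diag}\{\varphi_3(f_1(\mathbf{w})),\varphi_3(f_2(\mathbf{w})),\dots,\varphi_3(f_N(\mathbf{w})),\varphi_3(g_N(\mathbf{w})),\dots,\varphi_3(g_2(\mathbf{w})),\varphi_3(g_1(\mathbf{w}))\} \] for $\mathbf{w}\in\mathcal{A}_n^{\star}$ (notation in the context) is a faithful representation of $(\mathsf{baxt}_n,{}^{\sharp})$, i.e. a well-defined injective homomorphism of involution monoids.
   Context: Baxter monoid: for $n\ge 1$ let $\mathcal{A}_n=\{1<2<\cdots<n\}$ and let $\mathcal{A}_n^{\star}$ be the free monoid on $\mathcal{A}_n$ with empty word $\varepsilon$. Then $\mathsf{baxt}_n=\mathcal{A}_n^{\star}/\!\equiv$, where $\equiv$ is the congruence generated by all pairs $(c\mathbf{u}ad\mathbf{v}b,\ c\mathbf{u}da\mathbf{v}b)$ with $a\le b<c\le d$ and $(b\mathbf{u}da\mathbf{v}c,\ b\mathbf{u}ad\mathbf{v}c)$ with $a<b\le c<d$, where $a,b,c,d\in\mathcal{A}_n$, $\mathbf{u},\mathbf{v}\in\mathcal{A}_n^{\star}$; $[\mathbf{w}]$ denotes the class of $\mathbf{w}$. Schützenberger's involution $^{\sharp}$ on $\mathsf{baxt}_n$ is induced by $i^{\sharp}=n+1-i$ and $(w_1\cdots w_k)^{\sharp}=w_k^{\sharp}\cdots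 w_1^{\sharp}$ (this is compatible with $\equiv$). Semiring and matrices: $\mathbb{S}$ is a commutative idempotent semiring ($(S,+)$ and $(S,\cdot)$ are commutative monoids with identities $\mathbf{0}$ and $\mathbf{1}$ respectively, multiplication distributes over addition, $\mathbf{0}\cdot a=\mathbf{0}$, and $a+a=a$ for all $a$) containing an element $s$ of infinite multiplicative order ($s^i=s^j$ iff $i=j$, for non-negative integers $i,j$). $UT_m(\mathbb{S})$ is the monoid of upper triangular $m\times m$ matrices over $\mathbb{S}$; $^D$ is the skew transposition $(A^D)_{ij}=A_{(m+1-j)(m+1-i)}$, an involution on it. $\mathrm{E}_m$ is the identity matrix, $\mathsf{diag}\{\cdots\}$ denotes a block diagonal matrix, and \[ \mathrm{P}=\begin{pmatrix} s&\mathbf{0}\\ \mathbf{0}&\mathbf{1}\end{pmatrix},\quad \mathrm{Q}=\begin{pmatrix} \mathbf{1}&\mathbf{0}\\ \mathbf{0}&s\end{pmatrix},\quad \mathrm{J}=\begin{pmatrix} \mathbf{1}&\mathbf{1}\\ \mathbf{0}&\mathbf{0}\end{pmatrix},\quad \mathrm{K}=\begin{pmatrix} \mathbf{0}&\mathbf{1}\\ \mathbf{0}&\mathbf{1}\end{pmatrix}. \] The map $\varphi_3:(\mathsf{baxt}_3,{}^{\sharp})\to(UT_{15}(\mathbb{S}),{}^D)$ is the (well-defined, injective) homomorphism of involution monoids induced by $1\mapsto \mathsf{diag}\{s,\mathrm{P},\mathrm{P},\mathrm{E}_2,\mathbf{1},\mathrm{J},\mathrm{E}_2,\mathrm{J},\mathbf{1}\}$,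 $2\mapsto \mathsf{diag}\{\mathbf{1},\mathrm{K},\mathrm{K},\mathrm{P},s,\mathrm{Q},\mathrm{J},\mathrm{J},\mathbf{1}\}$, $3\mapsto \mathsf{diag}\{\mathbf{1},\mathrm{K},\mathrm{E}_2,\mathrm{K},\mathbf{1},\mathrm{E}_2,\mathrm{Q},\mathrm{Q},s\}$. The maps $\varphi_{ij}$: let $n\ge4$ and $1\le i<j\le n$. Define a monoid homomorphism $\varphi_{ij}=(\alpha_{ij},\beta_{ij}):\mathcal{A}_n^{\star}\to \mathsf{baxt}_3\times\mathsf{baxt}_3$ on letters $k\in\mathcal{A}_n$ as follows. (1) If $i^{\sharp}=j$, then $\alpha_{ij}=\beta_{ij}$ sends $i\mapsto[1]$, $j\mapsto[3]$, $k\mapsto[31]$ for $i<k<j$, and all other $k\mapsto[\varepsilon]$. (2) If $i^{\sharp}\ne j$, let $(p,q)=(i,j)$ when $j<i^{\sharp}$ and $(p,q)=(j^{\sharp},i^{\sharp})$ when $i^{\sharp}<j$ (so $p<q$ and $q^{\sharp}<p^{\sharp}$). Then $\alpha_{ij}$ sends $p\mapsto[1]$, $q\mapsto[2]$, $k\mapsto[21]$ for $p<k<q$, other $k\mapsto[\varepsilon]$; and $\beta_{ij}$ sends $q^{\sharp}\mapsto[2]$, $p^{\sharp}\mapsto[3]$, $k\mapsto[32]$ for $q^{\sharp}<k<p^{\sharp}$, other $k\mapsto[\varepsilon]$. Let $I_n=\{(i,j):1\le i<j\le n\}$, $N=|I_n|=n(n-1)/2$, fix an enumeration $(i_1,j_1),\dots,(i_N,j_N)$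 of $I_n$, and put $f_r=\alpha_{i_rj_r}$, $g_r=\beta_{i_rj_r}$ for $1\le r\le N$. *)

theory Defs
  imports "HOL-Algebra.Group" "Jordan_Normal_Form.Matrix"
begin

locale involution_monoid = monoid M for M (structure) +
  fixes star :: "'a \<Rightarrow> 'a"
  assumes star_closed: "x \<in> carrier M \<Longrightarrow> star x \<in> carrier M"
    and star_star: "x \<in> carrier M \<Longrightarrow> star (star x) = x"
    and star_mult: "\<lbrakk>x \<in> carrier M; y \<in> carrier M\<rbrakk> \<Longrightarrow> star (x \<otimes> y) = star y \<otimes> star x"

definition involution_monoid_hom ::
  "('a, 'm) monoid_scheme \<Rightarrow> ('a \<Rightarrow> 'a) \<Rightarrow> ('b, 'k) monoid_scheme \<Rightarrow> ('b \<Rightarrow> 'b) \<Rightarrow> ('a \<Rightarrow> 'b) \<Rightarrow> bool"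
  where
  "involution_monoid_hom M st N st' f \<longleftrightarrow>
     involution_monoid M st \<and> involution_monoid N st' \<and>
     f \<in> hom M N \<and> f \<one>\<^bsub>M\<^esub> = \<one>\<^bsub>N\<^esub> \<and> (\<forall>x \<in> carrier M. f (st x) = st' (f x))"

(* The extension to words of a map on letters into a monoid. *)
definition word_hom :: "('b, 'm) monoid_scheme \<Rightarrow> ('a \<Rightarrow> 'b) \<Rightarrow> 'a list \<Rightarrow> 'b" where
  "word_hom M f w = foldr (\<lambda>k x. f k \<otimes>\<^bsub>M\<^esub> x) w \<one>\<^bsub>M\<^esub>"


(* Words over the alphabet {1 < ... < n} are the elements of lists {1..n}. *)
inductive_set baxt_cong :: "nat \<Rightarrow> (nat list \<times> nat list) set" for n :: nat where
  rel1: "\<lbrakk>{a, b, c, d} \<subseteq> {1..n}; u \<in> lists {1..n}; v \<in> lists {1..n}; a \<le> b; b < c; c \<le> d\<rbrakk>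
    \<Longrightarrow> ([c] @ u @ [a, d] @ v @ [b], [c] @ u @ [d, a] @ v @ [b]) \<in> baxt_cong n"
| rel2: "\<lbrakk>{a, b, c, d} \<subseteq> {1..n}; u \<in> lists {1..n}; v \<in> lists {1..n}; a < b; b \<le> c; c < d\<rbrakk>
    \<Longrightarrow> ([b] @ u @ [d, a] @ v @ [c], [b] @ u @ [a, d] @ v @ [c]) \<in> baxt_cong n"
| refl: "w \<in> lists {1..n} \<Longrightarrow> (w, w) \<in> baxt_cong n"
| sym: "(u, v) \<in> baxt_cong n \<Longrightarrow> (v, u) \<in> baxt_cong n"
| trans: "\<lbrakk>(u, v) \<in> baxt_cong n; (v, w) \<in> baxt_cong n\<rbrakk> \<Longrightarrow> (u, w) \<in> baxt_cong n"
| mult: "\<lbrakk>(u, v) \<in> baxt_cong n; (u', v') \<in> baxt_cong n\<rbrakk> \<Longrightarrow> (u @ u', v @ v') \<in> baxt_cong n"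

definition baxt_class :: "nat \<Rightarrow> nat list \<Rightarrow> nat list set" where
  "baxt_class n w = baxt_cong n `` {w}"

definition baxt :: "nat \<Rightarrow> nat list set monoid" where
  "baxt n = \<lparr>carrier = lists {1..n} // baxt_cong n,
             mult = (\<lambda>X Y. \<Union>x\<in>X. \<Union>y\<in>Y. baxt_class n (x @ y)),
             one = baxt_class n []\<rparr>"

definition sharp :: "nat \<Rightarrow> nat \<Rightarrow> nat" where
  "sharp n i = n + 1 - i"

definition word_sharp :: "nat \<Rightarrow> nat list \<Rightarrow> nat list" where
  "word_sharp n w = rev (map (sharp n) w)"

definition baxt_sharp :: "nat \<Rightarrow> nat list set \<Rightarrow> nat list set" where
  "baxt_sharp n X = (\<Union>w\<in>X. baxt_class n (word_sharp n w))"


definition UT :: "nat \<Rightarrow> 'a::comm_semiring_1 mat monoid" where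
  "UT m = \<lparr>carrier = {A \<in> carrier_mat m m. upper_triangular A}, mult = (*), one = 1\<^sub>m m\<rparr>"

(* Entries are numbered from 0, so index m + 1 - i becomes m - 1 - i. *)
definition skew_transpose :: "'a mat \<Rightarrow> 'a mat" where
  "skew_transpose A =
     mat (dim_col A) (dim_row A) (\<lambda>(i, j). A $$ (dim_row A - 1 - j, dim_col A - 1 - i))"

definition mat_P :: "'a::comm_semiring_1 \<Rightarrow> 'a mat" where
  "mat_P s = mat_of_rows_list 2 [[s, 0], [0, 1]]"

definition mat_Q :: "'a::comm_semiring_1 \<Rightarrow> 'a mat" where
  "mat_Q s = mat_of_rows_list 2 [[1, 0], [0, s]]"

definition mat_J :: "'a::comm_semiring_1 mat" where
  "mat_J = mat_of_rows_list 2 [[1, 1], [0, 0]]"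

definition mat_K :: "'a::comm_semiring_1 mat" where
  "mat_K = mat_of_rows_list 2 [[0, 1], [0, 1]]"

definition mat_scalar :: "'a \<Rightarrow> 'a mat" where
  "mat_scalar x = mat_of_rows_list 1 [[x]]"

(* Only the values at the letters 1, 2, 3 matter. *)
definition phi3_letter :: "'a::comm_semiring_1 \<Rightarrow> nat \<Rightarrow> 'a mat" where
  "phi3_letter s k = diag_block_mat
     (if k = 1 then
        [mat_scalar s, mat_P s, mat_P s, 1\<^sub>m 2, mat_scalar 1, mat_J, 1\<^sub>m 2, mat_J, mat_scalar 1]
      else if k = 2 then
        [mat_scalar 1, mat_K, mat_K, mat_P s, mat_scalar s, mat_Q s, mat_J, mat_J, mat_scalar 1]
      else
        [mat_scalar 1, mat_K, 1\<^sub>m 2, mat_K, mat_scalar 1, 1\<^sub>m 2, mat_Q s, mat_Q s, mat_scalar s])"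

(* The map on classes induced by a map on words: the_elem returns the common value of that map
   on the class, and is unspecified unless there is one. *)
definition phi3 :: "'a::comm_semiring_1 \<Rightarrow> nat list set \<Rightarrow> 'a mat" where
  "phi3 s X = the_elem (word_hom (UT 15) (phi3_letter s) ` X)"


(* p is sent to a, q to b, every letter strictly between them to ba, all others to the empty word. *)
definition span_letter :: "nat \<Rightarrow> nat \<Rightarrow> nat \<Rightarrow> nat \<Rightarrow> nat \<Rightarrow> nat list" where
  "span_letter p q a b k =
     (if k = p then [a] else if k = q then [b] else if p < k \<and> k < q then [b, a] else [])"

(* The pair (p, q); relevant only if sharp n i is different from j. *)
definition pq :: "nat \<Rightarrow> nat \<Rightarrow> nat \<Rightarrow> nat \<times> nat" where
  "pq n i j = (if j < sharp n i then (i, j) else (sharp n j, sharp n i))"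

definition alpha_letter :: "nat \<Rightarrow> nat \<Rightarrow> nat \<Rightarrow> nat \<Rightarrow> nat list set" where
  "alpha_letter n i j k = baxt_class 3
     (if sharp n i = j then span_letter i j 1 3 k
      else (case pq n i j of (p, q) \<Rightarrow> span_letter p q 1 2 k))"

definition beta_letter :: "nat \<Rightarrow> nat \<Rightarrow> nat \<Rightarrow> nat \<Rightarrow> nat list set" where
  "beta_letter n i j k = baxt_class 3
     (if sharp n i = j then span_letter i j 1 3 k
      else (case pq n i j of (p, q) \<Rightarrow> span_letter (sharp n q) (sharp n p) 2 3 k))"

definition alpha :: "nat \<Rightarrow> nat \<Rightarrow> nat \<Rightarrow> nat list \<Rightarrow> nat list set" where
  "alpha n i j = word_hom (baxt 3) (alpha_letter n i j)"

definition beta :: "nat \<Rightarrow> nat \<Rightarrow> nat \<Rightarrow> nat list \<Rightarrow> nat list set" where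
  "beta n i j = word_hom (baxt 3) (beta_letter n i j)"

definition index_pairs :: "nat \<Rightarrow> (nat \<times> nat) set" where
  "index_pairs n = {(i, j). 1 \<le> i \<and> i < j \<and> j \<le> n}"

(* es is the chosen enumeration of index_pairs n. *)
definition phi_word :: "'a::comm_semiring_1 \<Rightarrow> nat \<Rightarrow> (nat \<times> nat) list \<Rightarrow> nat list \<Rightarrow> 'a mat" where
  "phi_word s n es w = diag_block_mat
     (map (\<lambda>(i, j). phi3 s (alpha n i j w)) es @ rev (map (\<lambda>(i, j). phi3 s (beta n i j w)) es))"

definition phi :: "'a::comm_semiring_1 \<Rightarrow> nat \<Rightarrow> (nat \<times> nat) list \<Rightarrow> nat list set \<Rightarrow> 'a mat" where
  "phi s n es X = the_elem (phi_word s n es ` X)"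

end

theory Submission
  imports Defs
begin

text \<open>
  Baxter congruence is governed by three kinds of data: the content of a word, the number
  \<open>lcount p q w\<close> of occurrences of \<open>p\<close> before the first letter in \<open>{p<..q}\<close>, and the number
  \<open>rcount p q w\<close> of occurrences of \<open>q\<close> after the last letter in \<open>{p..<q}\<close>. Adjacent letters \<open>e < d\<close>
  may be exchanged exactly when some earlier letter lies in \<open>{e<..d}\<close> and some later letter lies
  in \<open>{e..<d}\<close>; if two words share their invariants, this condition is met at every step of moving
  the first differing letter into its place, so the words are congruent.
  Products of the matrices P, K (respectively J, Q) record exactly \<open>lcount\<close> (respectively
  \<open>rcount\<close>), and the substitutions \<open>\<alpha>\<close> and \<open>\<beta>\<close> turn the invariants for \<open>p < q\<close> into
  invariants of words over three letters, where every pair \<open>(p, q)\<close> is seen by \<open>\<alpha>\<close> or by \<open>\<beta>\<close>.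
\<close>

subsection \<open>Invariants of the Baxter congruence\<close>

definition lcount :: "nat \<Rightarrow> nat \<Rightarrow> nat list \<Rightarrow> nat" where
  "lcount p q w = count_list (takeWhile (\<lambda>k. k \<notin> {p<..q}) w) p"

definition rcount :: "nat \<Rightarrow> nat \<Rightarrow> nat list \<Rightarrow> nat" where
  "rcount p q w = count_list (takeWhile (\<lambda>k. k \<notin> {p..<q}) (rev w)) q"

lemma lcount_append:
  "lcount p q (u @ v) =
     (if set u \<inter> {p<..q} = {} then count_list u p + lcount p q v else lcount p q u)"
proof (cases "set u \<inter> {p<..q} = {}")
  case True
  then have "\<And>x. x \<in> set u \<Longrightarrow> x \<notin> {p<..q}" by blast
  then show ?thesis using True by (simp add: lcount_def takeWhile_append2)
next
  case False
  then obtain x where "x \<in> set u" "x \<in> {p<..q}" by blast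
  then show ?thesis using False by (simp add: lcount_def takeWhile_append1)
qed

lemma lcount_Cons:
  "lcount p q (k # v) = (if k \<in> {p<..q} then 0 else (if k = p then 1 else 0) + lcount p q v)"
  by (simp add: lcount_def)

lemma lcount_Nil [simp]: "lcount p q [] = 0"
  by (simp add: lcount_def)

lemma rcount_append:
  "rcount p q (u @ v) =
     (if set v \<inter> {p..<q} = {} then count_list v q + rcount p q u else rcount p q v)"
proof (cases "set v \<inter> {p..<q} = {}")
  case True
  then have "takeWhile (\<lambda>k. k \<notin> {p..<q}) (rev v @ rev u) = rev v @ takeWhile (\<lambda>k. k \<notin> {p..<q}) (rev u)"
    by (intro takeWhile_append2) auto
  then show ?thesis using True by (simp add: rcount_def)
next
  case False
  then obtain x where "x \<in> set v" "x \<in> {p..<q}" by blast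
  then have "takeWhile (\<lambda>k. k \<notin> {p..<q}) (rev v @ rev u) = takeWhile (\<lambda>k. k \<notin> {p..<q}) (rev v)"
    by (intro takeWhile_append1) auto
  then show ?thesis using False by (simp add: rcount_def)
qed

lemma rcount_Nil [simp]: "rcount p q [] = 0"
  by (simp add: rcount_def)

lemma rcount_Cons:
  "rcount p q (k # v) =
     (if set v \<inter> {p..<q} = {} then count_list v q + (if k = q then 1 else 0) else rcount p q v)"
  using rcount_append[of p q "[k]" v] by (auto simp: rcount_def)

definition same_invariants :: "nat \<Rightarrow> nat list \<Rightarrow> nat list \<Rightarrow> bool" where
  "same_invariants n u v \<longleftrightarrow> mset u = mset v \<and>
     (\<forall>p q. 1 \<le> p \<longrightarrow> p < q \<longrightarrow> q \<le> n \<longrightarrow> lcount p q u = lcount p q v \<and> rcount p q u = rcount p q v)"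

lemma baxt_cong_lists:
  "(u, v) \<in> baxt_cong n \<Longrightarrow> u \<in> lists {1..n} \<and> v \<in> lists {1..n}"
  by (induction rule: baxt_cong.induct) auto

lemma count_list_eq_if_mset_eq: "mset u = mset v \<Longrightarrow> count_list u k = count_list v k"
  by (metis count_mset)

text \<open>Exchanging neighbours can change \<open>lcount p q\<close> only if one of them is
  \<open>p\<close> and the other lies in \<open>{p<..q}\<close>. As \<open>e < d\<close>, this
  forces \<open>p = e\<close> and \<open>d \<le> q\<close>, and then the letter of
  \<open>{e<..d}\<close> in \<open>x\<close> has already ended the count. Dually,
  \<open>rcount p q\<close> could change only for \<open>q = d\<close> and \<open>p \<le> e\<close>,
  where the letter of \<open>{e..<d}\<close> in \<open>z\<close> ends the count first.\<close>

lemma same_invariants_swap: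
  assumes "set x \<inter> {e<..d} \<noteq> {}" and "set z \<inter> {e..<d} \<noteq> {}" and "e < d"
  shows "same_invariants n (x @ [e, d] @ z) (x @ [d, e] @ z)"
proof -
  obtain g where g: "g \<in> set x" "e < g" "g \<le> d" using assms(1) by auto
  obtain h where h: "h \<in> set z" "e \<le> h" "h < d" using assms(2) by auto
  have "lcount p q (x @ [e, d] @ z) = lcount p q (x @ [d, e] @ z)" if "p < q" for p q
  proof (cases "set x \<inter> {p<..q} = {}")
    case True
    then have "g \<notin> {p<..q}" using g by blast
    with True show ?thesis using g that by (auto simp: lcount_append lcount_Cons)
  qed (simp add: lcount_append)
  moreover have "rcount p q (x @ [e, d] @ z) = rcount p q (x @ [d, e] @ z)" if "p < q" for p q
  proof (cases "set z \<inter> {p..<q} = {}")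
    case True
    then have "h \<notin> {p..<q}" using h by blast
    with True show ?thesis using h that by (auto simp: rcount_append rcount_Cons)
  qed (simp add: rcount_append rcount_Cons)
  ultimately show ?thesis by (simp add: same_invariants_def)
qed

lemma same_invariants_sym: "same_invariants n u v \<Longrightarrow> same_invariants n v u"
  by (simp add: same_invariants_def)

text \<open>Both generating relations exchange letters \<open>a < d\<close> with a letter of
  \<open>{a<..d}\<close> in front and a letter of \<open>{a..<d}\<close> behind.\<close>

lemma baxt_cong_same_invariants:
  assumes "(u, v) \<in> baxt_cong n"
  shows "same_invariants n u v"
  using assms
proof induction
  case (rel1 a b c d u v)
  then show ?case using same_invariants_swap[of "c # u" a d "v @ [b]" n] by simp
next
  case (rel2 a b c d u v)
  then show ?case using same_invariants_sym[OF same_invariants_swap[of "b # u" a d "v @ [c]" n]] by simp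
next
  case (mult u v u' v')
  \<comment> \<open>The append rules branch on the letters occurring in one factor and use its plain
    counts, so equality of the contents enters here as well.\<close>
  have "set u = set v" "set u' = set v'"
    using mult.IH by (metis same_invariants_def set_mset_mset)+
  then show ?case
    using mult.IH by (auto simp: same_invariants_def lcount_append rcount_append
        dest: count_list_eq_if_mset_eq)
qed (auto simp: same_invariants_def)

section \<open>From equal invariants to congruence\<close>

lemma baxt_cong_context:
  assumes "(u, v) \<in> baxt_cong n" "x \<in> lists {1..n}" "y \<in> lists {1..n}"
  shows "(x @ u @ y, x @ v @ y) \<in> baxt_cong n"
  using assms by (intro baxt_cong.mult baxt_cong.refl)

text \<open>With \<open>g\<close> in front and \<open>h\<close> behind, the two defining relations
  correspond to the two possible orders: \<open>e \<le> h < g \<le> d\<close> is the first one,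
  \<open>e < g \<le> h < d\<close> the second.\<close>

lemma baxt_cong_swap:
  assumes "x @ e # d # z \<in> lists {1..n}" "e < d"
    and "set x \<inter> {e<..d} \<noteq> {}" and "set z \<inter> {e..<d} \<noteq> {}"
  shows "(x @ e # d # z, x @ d # e # z) \<in> baxt_cong n"
proof -
  obtain g where g: "g \<in> set x" "e < g" "g \<le> d" using assms(3) by auto
  obtain h where h: "h \<in> set z" "e \<le> h" "h < d" using assms(4) by auto
  obtain x1 x2 where x: "x = x1 @ g # x2" using g(1) by (meson split_list)
  obtain z1 z2 where z: "z = z1 @ h # z2" using h(1) by (meson split_list)
  have "([g] @ x2 @ [e, d] @ z1 @ [h], [g] @ x2 @ [d, e] @ z1 @ [h]) \<in> baxt_cong n"
  proof (cases "h < g")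
    case True
    then show ?thesis using assms(1) g h unfolding x z by (intro rel1) auto
  next
    case False
    then show ?thesis
      using assms(1,2) g h unfolding x z by (intro baxt_cong.sym[OF rel2]) auto
  qed
  from baxt_cong_context[OF this, of x1 z2] show ?thesis using assms(1) by (simp add: x z)
qed

lemma same_invariants_trans:
  "same_invariants n u v \<Longrightarrow> same_invariants n v w \<Longrightarrow> same_invariants n u w"
  by (simp add: same_invariants_def)

lemma rcount_le: "rcount p q w \<le> count_list w q"
  by (metis count_list_append count_list_rev le_add1 rcount_def takeWhile_dropWhile_id)

text \<open>Here \<open>x\<close> is the common prefix, \<open>d\<close> the next letter of the
  target word, and \<open>e\<close> stands directly before the first \<open>d\<close> after
  \<open>x\<close>. If a letter permitting the exchange were missing, an invariant would separate
  the two words.\<close>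

lemma swap_before_first_difference:
  assumes w: "x @ y @ e # d # z \<in> lists {1..n}" and d: "d \<notin> set (y @ [e])"
    and inv: "same_invariants n (x @ y @ e # d # z) (x @ d # t)"
  shows "(x @ y @ e # d # z, x @ y @ d # e # z) \<in> baxt_cong n"
proof -
  have cnt: "count_list (x @ y @ e # d # z) k = count_list (x @ d # t) k" for k
    by (rule count_list_eq_if_mset_eq) (use inv in \<open>simp add: same_invariants_def\<close>)
  have td: "count_list t d = count_list z d"
    using cnt[of d] d by (simp add: count_list_0_iff)
  have te: "count_list t e = count_list y e + 1 + count_list z e"
    using cnt[of e] d by simp
  then have e_t: "e \<in> set t" by (metis add_is_0 count_list_0_iff one_neq_zero)
  have ln: "1 \<le> e" "e \<le> n" "1 \<le> d" "d \<le> n" using w by auto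
  consider "e < d" | "d < e" using d by force
  then show ?thesis
  proof cases
    case 1
    have L: "lcount e d (x @ y @ e # d # z) = lcount e d (x @ d # t)"
      and R: "rcount e d (x @ y @ e # d # z) = rcount e d (x @ d # t)"
      using inv 1 ln by (auto simp: same_invariants_def)
    \<comment> \<open>Otherwise \<open>lcount e d\<close> counts the displayed \<open>e\<close> in
      the first word, while in the target the \<open>d\<close> right after \<open>x\<close> stops
      the count.\<close>
    have "set (x @ y) \<inter> {e<..d} \<noteq> {}"
    proof
      assume "set (x @ y) \<inter> {e<..d} = {}"
      then have "set x \<inter> {e<..d} = {}" "set y \<inter> {e<..d} = {}" by auto
      then show False using L 1 by (simp add: lcount_append lcount_Cons)
    qed
    \<comment> \<open>Otherwise \<open>rcount e d\<close> counts the displayed \<open>d\<close> on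
      top of those in \<open>z\<close>, while in the target an \<open>e\<close> inside
      \<open>t\<close> stops the count before the displayed \<open>d\<close> is reached.\<close>
    moreover have "set z \<inter> {e..<d} \<noteq> {}"
    proof
      assume "set z \<inter> {e..<d} = {}"
      then have "rcount e d (x @ y @ e # d # z) = count_list z d + 1"
        using 1 by (simp add: rcount_append rcount_Cons)
      moreover have "rcount e d (x @ d # t) \<le> count_list t d"
        using e_t 1 rcount_le[of e d t] by (auto simp: rcount_append rcount_Cons)
      ultimately show False using R td by simp
    qed
    ultimately show ?thesis using baxt_cong_swap[of "x @ y" e d z n] w 1 by simp
  next
    case 2
    have L: "lcount d e (x @ y @ e # d # z) = lcount d e (x @ d # t)"
      and R: "rcount d e (x @ y @ e # d # z) = rcount d e (x @ d # t)"
      using inv 2 ln by (auto simp: same_invariants_def)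
    have y_d: "count_list y d = 0" using d by (simp add: count_list_0_iff)
    \<comment> \<open>Now the target counts the \<open>d\<close> after \<open>x\<close>, while in
      the first word \<open>e\<close> stops \<open>lcount d e\<close> before any \<open>d\<close>
      beyond \<open>x\<close>.\<close>
    have "set (x @ y) \<inter> {d<..e} \<noteq> {}"
    proof
      assume "set (x @ y) \<inter> {d<..e} = {}"
      then have "set x \<inter> {d<..e} = {}" "set y \<inter> {d<..e} = {}" by auto
      then show False using L 2 y_d by (simp add: lcount_append lcount_Cons)
    qed
    moreover have "set z \<inter> {d..<e} \<noteq> {}"
    proof
      assume z: "set z \<inter> {d..<e} = {}"
      then have Rw: "rcount d e (x @ d # t) = count_list z e"
        using 2 R by (simp add: rcount_append rcount_Cons)
      have "d \<notin> set z" using z 2 by auto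
      then have "d \<notin> set t" using td by (simp add: count_list_0_iff)
      \<comment> \<open>If letters of \<open>{d..<e}\<close> remain in \<open>t\<close>, the pair \<open>(d, e)\<close> cannot tell the words apart,
        but \<open>(Suc d, e)\<close> does, because \<open>d\<close> does not occur in \<open>t\<close>.\<close>
      show False
      proof (cases "set t \<inter> {d..<e} = {}")
        case True
        then show False using Rw te 2 by (simp add: rcount_append rcount_Cons)
      next
        case False
        then obtain f where f: "f \<in> set t" "d \<le> f" "f < e" by auto
        with \<open>d \<notin> set t\<close> have "d < f" by (metis le_neq_implies_less)
        have sub: "set t \<inter> {d..<e} = set t \<inter> {Suc d..<e}"
          using \<open>d \<notin> set t\<close> by (auto simp: Suc_le_eq intro: le_neq_implies_less)
        have restrict: "takeWhile (\<lambda>k. k \<notin> {d..<e}) (rev t) = takeWhile (\<lambda>k. k \<notin> {Suc d..<e}) (rev t)"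
          using sub by (intro takeWhile_cong) auto
        have "rcount (Suc d) e (x @ d # t) = rcount (Suc d) e t"
          using False sub by (simp add: rcount_append rcount_Cons)
        also have "\<dots> = rcount d e t" unfolding rcount_def restrict ..
        also have "\<dots> = count_list z e" using Rw False 2 by (simp add: rcount_append rcount_Cons)
        finally have 3: "rcount (Suc d) e (x @ d # t) = count_list z e" .
        have "set z \<inter> {Suc d..<e} = {}" using z by auto
        then have "rcount (Suc d) e (x @ y @ e # d # z) \<ge> count_list z e + 1"
          using 2 by (simp add: rcount_append rcount_Cons)
        moreover have "rcount (Suc d) e (x @ y @ e # d # z) = rcount (Suc d) e (x @ d # t)"
          using inv ln \<open>d < f\<close> f by (auto simp: same_invariants_def)
        ultimately show False using 3 by simp
      qed
    qed
    ultimately have "(x @ y @ d # e # z, x @ y @ e # d # z) \<in> baxt_cong n"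
      using baxt_cong_swap[of "x @ y" d e z n] w 2 by simp
    then show ?thesis by (rule baxt_cong.sym)
  qed
qed

text \<open>The letter \<open>d\<close> travels leftwards through \<open>y\<close>, passing its last
  letter first, hence the reverse induction. Each exchange is a congruence, so the new word still
  shares its invariants with the target, as the next exchange requires.\<close>

lemma move_to_first_difference:
  assumes "x @ y @ d # z \<in> lists {1..n}" "d \<notin> set y"
    and "same_invariants n (x @ y @ d # z) (x @ d # t)"
  shows "(x @ y @ d # z, x @ d # y @ z) \<in> baxt_cong n"
  using assms
proof (induction y arbitrary: z rule: rev_induct)
  case Nil
  then show ?case using baxt_cong.refl[of "x @ d # z" n] by simp
next
  case (snoc e y)
  have swap: "(x @ y @ e # d # z, x @ y @ d # e # z) \<in> baxt_cong n"
    using snoc.prems by (intro swap_before_first_difference[of x y e d z n t]) auto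
  then have "same_invariants n (x @ y @ d # e # z) (x @ d # t)"
    using same_invariants_trans[OF same_invariants_sym[OF baxt_cong_same_invariants[OF swap]]]
      snoc.prems(3) by simp
  then have "(x @ y @ d # e # z, x @ d # y @ e # z) \<in> baxt_cong n"
    using snoc.prems by (intro snoc.IH) auto
  with swap show ?case using baxt_cong.trans[OF swap] by simp
qed

text \<open>The prefix \<open>x\<close> collects the letters already matched with the target; each
  step brings the next target letter to the front of the remainder \<open>r\<close>.\<close>

lemma same_invariants_suffix_baxt_cong:
  assumes "x @ r \<in> lists {1..n}" and "same_invariants n (x @ r) (x @ t)"
  shows "(x @ r, x @ t) \<in> baxt_cong n"
  using assms
proof (induction t arbitrary: x r)
  case Nil
  then have "mset r = {#}" by (simp add: same_invariants_def)
  then show ?case using Nil by (auto intro: baxt_cong.refl)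
next
  case (Cons d t)
  have "mset r = mset (d # t)" using Cons.prems by (simp add: same_invariants_def)
  then have "d \<in> set r" by (metis list.set_intros(1) set_mset_mset)
  then obtain y z where r: "r = y @ d # z" "d \<notin> set y" by (meson split_list_first)
  have move: "(x @ r, (x @ [d]) @ y @ z) \<in> baxt_cong n"
    using move_to_first_difference[of x y d z n t] Cons.prems r by simp
  moreover have "((x @ [d]) @ y @ z, (x @ [d]) @ t) \<in> baxt_cong n"
  proof (rule Cons.IH)
    show "(x @ [d]) @ y @ z \<in> lists {1..n}" using baxt_cong_lists[OF move] by simp
    show "same_invariants n ((x @ [d]) @ y @ z) ((x @ [d]) @ t)"
      using same_invariants_trans[OF same_invariants_sym[OF baxt_cong_same_invariants[OF move]]]
        Cons.prems(2) by simp
  qed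
  ultimately have "(x @ r, (x @ [d]) @ t) \<in> baxt_cong n" by (rule baxt_cong.trans)
  then show ?case by simp
qed

theorem baxt_cong_iff_same_invariants:
  "(u, v) \<in> baxt_cong n \<longleftrightarrow> u \<in> lists {1..n} \<and> same_invariants n u v"
proof
  assume "(u, v) \<in> baxt_cong n"
  then show "u \<in> lists {1..n} \<and> same_invariants n u v"
    using baxt_cong_same_invariants baxt_cong_lists by blast
next
  assume "u \<in> lists {1..n} \<and> same_invariants n u v"
  then show "(u, v) \<in> baxt_cong n"
    using same_invariants_suffix_baxt_cong[of "[]" u n v] by simp
qed

subsection \<open>Upper triangular and block diagonal matrices\<close>

lemma word_hom_Nil [simp]: "word_hom M f [] = \<one>\<^bsub>M\<^esub>"
  and word_hom_Cons: "word_hom M f (k # w) = f k \<otimes>\<^bsub>M\<^esub> word_hom M f w"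
  by (simp_all add: word_hom_def)

lemma (in monoid) word_hom_closed:
  "(\<And>k. k \<in> set w \<Longrightarrow> f k \<in> carrier G) \<Longrightarrow> word_hom G f w \<in> carrier G"
  by (induction w) (auto simp: word_hom_Cons)

lemma (in monoid) word_hom_append:
  assumes "\<And>k. k \<in> set (u @ v) \<Longrightarrow> f k \<in> carrier G"
  shows "word_hom G f (u @ v) = word_hom G f u \<otimes> word_hom G f v"
  using assms
proof (induction u)
  case Nil
  then show ?case by (simp add: word_hom_closed)
next
  case (Cons k u)
  have "word_hom G f u \<in> carrier G" "word_hom G f v \<in> carrier G" "f k \<in> carrier G"
    using Cons.prems by (auto intro!: word_hom_closed)
  with Cons show ?case by (simp add: word_hom_Cons m_assoc)
qed

lemma UT_simps [simp]:
  "carrier (UT m) = {A \<in> carrier_mat m m. upper_triangular A}"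
  "(\<otimes>\<^bsub>UT m\<^esub>) = (*)" "\<one>\<^bsub>UT m\<^esub> = 1\<^sub>m m"
  by (simp_all add: UT_def)

lemma upper_triangular_mult:
  fixes A B :: "'a::semiring_0 mat"
  assumes A: "A \<in> carrier_mat m m" "upper_triangular A"
    and B: "B \<in> carrier_mat m m" "upper_triangular B"
  shows "upper_triangular (A * B)"
proof
  fix i j assume ij: "j < i" "i < dim_row (A * B)"
  have "row A i \<bullet> col B j = (\<Sum>k = 0..<m. A $$ (i, k) * B $$ (k, j))"
    using A B ij by (auto simp: scalar_prod_def)
  also have "\<dots> = 0"
  proof (rule sum.neutral, rule ballI)
    \<comment> \<open>A nonzero product would need \<open>i \<le> k\<close> and
      \<open>k \<le> j\<close>, against \<open>j < i\<close>.\<close>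
    fix k assume "k \<in> {0..<m}"
    then have "A $$ (i, k) = 0 \<or> B $$ (k, j) = 0"
      using A B ij upper_triangularD[OF A(2), of k i] upper_triangularD[OF B(2), of j k]
      by (cases "k < i") auto
    then show "A $$ (i, k) * B $$ (k, j) = 0" by auto
  qed
  finally show "(A * B) $$ (i, j) = 0" using A B ij by simp
qed

lemma UT_monoid: "monoid (UT m)"
  by (rule monoidI) (auto intro: upper_triangular_mult assoc_mult_mat)

lemma skew_transpose_carrier:
  "A \<in> carrier_mat m m' \<Longrightarrow> skew_transpose A \<in> carrier_mat m' m"
  by (auto simp: skew_transpose_def)

lemma skew_transpose_index:
  "A \<in> carrier_mat m m' \<Longrightarrow> i < m' \<Longrightarrow> j < m \<Longrightarrow>
    skew_transpose A $$ (i, j) = A $$ (m - 1 - j, m' - 1 - i)"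
  by (auto simp: skew_transpose_def)

lemma skew_transpose_mult:
  fixes A B :: "'a::comm_semiring_0 mat"
  assumes A: "A \<in> carrier_mat m m" and B: "B \<in> carrier_mat m m"
  shows "skew_transpose (A * B) = skew_transpose B * skew_transpose A"
proof (rule eq_matI)
  note s = skew_transpose_carrier[OF A] skew_transpose_carrier[OF B]
  fix i j assume "i < dim_row (skew_transpose B * skew_transpose A)"
    "j < dim_col (skew_transpose B * skew_transpose A)"
  then have ij: "i < m" "j < m" using s by auto
  have "skew_transpose (A * B) $$ (i, j) = (A * B) $$ (m - 1 - j, m - 1 - i)"
    using A B ij by (intro skew_transpose_index) auto
  also have "\<dots> = (\<Sum>k<m. A $$ (m - 1 - j, k) * B $$ (k, m - 1 - i))"
    using A B ij by (auto simp: scalar_prod_def lessThan_atLeast0)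
  \<comment> \<open>Counting \<open>k\<close> from the other end turns both factors into entries of
    skew transposes; putting them in reversed order then uses commutativity of the scalars.\<close>
  also have "\<dots> = (\<Sum>k<m. A $$ (m - 1 - j, m - Suc k) * B $$ (m - Suc k, m - 1 - i))"
    by (rule sum.nat_diff_reindex[symmetric])
  also have "\<dots> = (\<Sum>k<m. skew_transpose B $$ (i, k) * skew_transpose A $$ (k, j))"
    using A B ij by (intro sum.cong) (auto simp: skew_transpose_def mult.commute)
  also have "\<dots> = (skew_transpose B * skew_transpose A) $$ (i, j)"
    using s ij by (auto simp: scalar_prod_def lessThan_atLeast0)
  finally show "skew_transpose (A * B) $$ (i, j) = (skew_transpose B * skew_transpose A) $$ (i, j)" .
qed (use A B in \<open>auto simp: skew_transpose_def\<close>)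

lemma UT_involution_monoid: "involution_monoid (UT m :: 'a::comm_semiring_1 mat monoid) skew_transpose"
proof -
  interpret monoid "UT m :: 'a mat monoid" by (rule UT_monoid)
  show ?thesis
  proof
    fix A assume A: "A \<in> carrier (UT m :: 'a mat monoid)"
    show "skew_transpose A \<in> carrier (UT m)"
      using A by (auto simp: skew_transpose_def upper_triangular_def)
    show "skew_transpose (skew_transpose A) = A"
      using A by (auto simp: skew_transpose_def)
  qed (auto intro: skew_transpose_mult)
qed

section \<open>Block diagonal matrices: products, injectivity, skew transposition\<close>

lemma diag_block_mat_carrier:
  "(\<And>A. A \<in> set As \<Longrightarrow> A \<in> carrier_mat m m) \<Longrightarrow>
    diag_block_mat As \<in> carrier_mat (m * length As) (m * length As)"
  by (induction As) (auto simp: Let_def)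

lemma diag_block_mat_mult:
  fixes As Bs :: "'a::comm_semiring_1 mat list"
  assumes "list_all2 (\<lambda>A B. square_mat A \<and> square_mat B \<and> dim_row A = dim_row B) As Bs"
  shows "diag_block_mat As * diag_block_mat Bs = diag_block_mat (map2 (*) As Bs)"
  using assms
proof (induction rule: list_all2_induct)
  case Nil
  then show ?case by auto
next
  case (Cons A As B Bs)
  define m k where "m = dim_row A" and "k = sum_list (map dim_row As)"
  have sq: "Ball (set As) square_mat" "Ball (set Bs) square_mat"
    using Cons.hyps(2) by (auto simp: list_all2_conv_all_nth in_set_conv_nth)
  have "map dim_row As = map dim_row Bs"
    using Cons.hyps(2) by (auto simp: list_all2_conv_all_nth intro: nth_equalityI)
  then have k: "diag_block_mat As \<in> carrier_mat k k" "diag_block_mat Bs \<in> carrier_mat k k"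
    using diag_block_mat_square[OF sq(1)] diag_block_mat_square[OF sq(2)]
    by (auto simp: dim_diag_block_mat k_def)
  have m: "A \<in> carrier_mat m m" "B \<in> carrier_mat m m" using Cons.hyps(1) by (auto simp: m_def)
  have mk: "diag_block_mat As * diag_block_mat Bs \<in> carrier_mat k k" "A * B \<in> carrier_mat m m"
    using k m by auto
  have dims: "dim_row A = m" "dim_col A = m" "dim_row B = m" "dim_col B = m"
    "dim_row (diag_block_mat As) = k" "dim_col (diag_block_mat As) = k"
    "dim_row (diag_block_mat Bs) = k" "dim_col (diag_block_mat Bs) = k"
    using k m by auto
  have dims': "dim_row (diag_block_mat (map2 (*) As Bs)) = k"
    "dim_col (diag_block_mat (map2 (*) As Bs)) = k"
    using mk(1) unfolding Cons.IH by auto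
  \<comment> \<open>Writing all dimensions as \<open>m\<close> and \<open>k\<close> gives both
    factors the shape expected by \<open>mult_four_block_mat\<close>; the mixed terms vanish and
    leave \<open>A * B\<close> and the product of the tails.\<close>
  show ?case
    unfolding diag_block_mat.simps list.map zip_Cons_Cons prod.case Let_def dims dims'
      mult_four_block_mat[OF m(1) zero_carrier_mat zero_carrier_mat k(1)
        m(2) zero_carrier_mat zero_carrier_mat k(2)]
    using mk by (simp add: Cons.IH dims dims')
qed

lemma four_block_mat_diag_inject:
  assumes "four_block_mat A (0\<^sub>m m' k) (0\<^sub>m m k') B = four_block_mat C (0\<^sub>m m' k) (0\<^sub>m m k') D"
    and "dim_row A = dim_row C" "dim_col A = dim_col C" "dim_row B = dim_row D" "dim_col B = dim_col D"
  shows "A = C" "B = D"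
proof -
  let ?L = "four_block_mat A (0\<^sub>m m' k) (0\<^sub>m m k') B" and ?R = "four_block_mat C (0\<^sub>m m' k) (0\<^sub>m m k') D"
  have L: "?L $$ (i, j) = ?R $$ (i, j)" for i j using assms(1) by simp
  show "A = C"
  proof (rule eq_matI)
    fix i j assume "i < dim_row C" "j < dim_col C"
    then show "A $$ (i, j) = C $$ (i, j)" using L[of i j] assms(2-5) by simp
  qed (use assms in auto)
  show "B = D"
  proof (rule eq_matI)
    fix i j assume "i < dim_row D" "j < dim_col D"
    then show "B $$ (i, j) = D $$ (i, j)"
      using L[of "i + dim_row C" "j + dim_col C"] assms(2-5) by simp
  qed (use assms in auto)
qed

text \<open>The blocks can be read off because the dimensions fix their boundaries; a bare matrix
  may split into diagonal blocks in several ways.\<close>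

lemma diag_block_mat_inject:
  assumes "list_all2 (\<lambda>A B. dim_row A = dim_row B \<and> dim_col A = dim_col B) As Bs"
    and "diag_block_mat As = diag_block_mat Bs"
  shows "As = Bs"
  using assms
proof (induction rule: list_all2_induct)
  case (Cons A As B Bs)
  have "map dim_row As = map dim_row Bs" "map dim_col As = map dim_col Bs"
    using Cons.hyps(2) by (auto simp: list_all2_conv_all_nth intro: nth_equalityI)
  then have d: "dim_row (diag_block_mat As) = dim_row (diag_block_mat Bs)"
    "dim_col (diag_block_mat As) = dim_col (diag_block_mat Bs)"
    by (simp_all add: dim_diag_block_mat)
  note eq = Cons.prems[unfolded diag_block_mat.simps Let_def]
  have h: "dim_row A = dim_row B" "dim_col A = dim_col B" using Cons.hyps(1) by auto
  note inj = four_block_mat_diag_inject[OF eq[unfolded h d] h d]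
  show ?case using inj Cons.IH by simp
qed simp

lemma skew_transpose_four_block:
  assumes A: "A \<in> carrier_mat m m" and B: "B \<in> carrier_mat k k"
  shows "skew_transpose (four_block_mat A (0\<^sub>m m k) (0\<^sub>m k m) B) =
    four_block_mat (skew_transpose B) (0\<^sub>m k m) (0\<^sub>m m k) (skew_transpose A)"
  by (rule eq_matI) (use A B in \<open>auto simp: skew_transpose_def\<close>)

text \<open>Reflection in the antidiagonal reverses the order of the blocks. This is why the block
  lists of \<open>phi3_letter\<close> and \<open>phi_word\<close> are arranged as mirror
  images.\<close>

lemma skew_transpose_diag_block_mat:
  assumes "\<And>A. A \<in> set As \<Longrightarrow> square_mat A"
  shows "skew_transpose (diag_block_mat As) = diag_block_mat (rev (map skew_transpose As))"
  using assms
proof (induction As)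
  case Nil
  then show ?case by (auto simp: skew_transpose_def)
next
  case (Cons A As)
  define m k where "m = dim_row A" and "k = sum_list (map dim_row As)"
  have k: "diag_block_mat As \<in> carrier_mat k k"
    using diag_block_mat_square[of As] Cons.prems by (auto simp: k_def dim_diag_block_mat)
  have m: "A \<in> carrier_mat m m" using Cons.prems[of A] by (auto simp: m_def)
  have dims: "dim_row A = m" "dim_col A = m"
    "dim_row (diag_block_mat As) = k" "dim_col (diag_block_mat As) = k"
    "dim_row (skew_transpose A) = m" "dim_col (skew_transpose A) = m"
    "dim_row (skew_transpose (diag_block_mat As)) = k" "dim_col (skew_transpose (diag_block_mat As)) = k"
    using k m by (auto simp: skew_transpose_def)
  have IH: "diag_block_mat (rev (map skew_transpose As)) = skew_transpose (diag_block_mat As)"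
    using Cons by simp
  show ?case
    unfolding diag_block_mat.simps Let_def dims skew_transpose_four_block[OF m k]
    by (simp add: diag_block_mat_last Let_def IH dims)
qed

section \<open>Explicit blocks of size two and one\<close>

definition mat2 :: "'a \<Rightarrow> 'a \<Rightarrow> 'a \<Rightarrow> 'a \<Rightarrow> 'a mat" where
  "mat2 a b c d = mat_of_rows_list 2 [[a, b], [c, d]]"

lemma mat2_carrier [simp]: "mat2 a b c d \<in> carrier_mat 2 2"
  by (rule carrier_matI) (simp_all add: mat2_def mat_of_rows_list_def)

lemma dim_mat2 [simp]: "dim_row (mat2 a b c d) = 2" "dim_col (mat2 a b c d) = 2"
  by (simp_all add: mat2_def mat_of_rows_list_def)

lemma mat2_index [simp]:
  "mat2 a b c d $$ (0, 0) = a" "mat2 a b c d $$ (0, Suc 0) = b"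
  "mat2 a b c d $$ (Suc 0, 0) = c" "mat2 a b c d $$ (Suc 0, Suc 0) = d"
  by (simp_all add: mat2_def mat_of_rows_list_def)

lemma mat2_eqI:
  assumes "A \<in> carrier_mat 2 2" "A $$ (0, 0) = a" "A $$ (0, 1) = b" "A $$ (1, 0) = c" "A $$ (1, 1) = d"
  shows "A = mat2 a b c d"
  by (rule eq_matI) (use assms in \<open>auto simp: less_2_cases_iff\<close>)

lemma mat2_mult:
  fixes a b c d :: "'a::semiring_0"
  shows "mat2 a b c d * mat2 a' b' c' d' =
    mat2 (a * a' + b * c') (a * b' + b * d') (c * a' + d * c') (c * b' + d * d')"
  by (rule mat2_eqI) (auto simp: scalar_prod_def numeral_2_eq_2)

lemma mat2_inject [simp]: "mat2 a b c d = mat2 a' b' c' d' \<longleftrightarrow> a = a' \<and> b = b' \<and> c = c' \<and> d = d'"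
  by (metis mat2_index)

lemma one_mat2: "1\<^sub>m 2 = mat2 1 0 0 1"
  by (rule mat2_eqI) auto

lemma skew_transpose_mat2: "skew_transpose (mat2 a b c d) = mat2 d b c a"
  by (rule mat2_eqI) (auto simp: skew_transpose_def)

lemma mat_scalar_carrier [simp]: "mat_scalar x \<in> carrier_mat 1 1"
  by (simp add: mat_scalar_def mat_of_rows_list_def)

lemma dim_mat_scalar [simp]: "dim_row (mat_scalar x) = Suc 0" "dim_col (mat_scalar x) = Suc 0"
  by (simp_all add: mat_scalar_def mat_of_rows_list_def)

lemma mat_scalar_index [simp]: "mat_scalar x $$ (0, 0) = x"
  by (simp add: mat_scalar_def mat_of_rows_list_def)

lemma mat_scalar_inject [simp]: "mat_scalar x = mat_scalar y \<longleftrightarrow> x = y"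
  by (metis mat_scalar_index)

lemma mat_scalar_mult: "mat_scalar x * mat_scalar y = mat_scalar (x * y :: 'a::semiring_0)"
  by (rule eq_matI) (auto simp: scalar_prod_def)

lemma one_mat_scalar: "1\<^sub>m 1 = mat_scalar 1"
  by (rule eq_matI) auto

lemma skew_transpose_mat_scalar: "skew_transpose (mat_scalar x) = mat_scalar x"
  by (rule eq_matI) (auto simp: skew_transpose_def)

subsection \<open>The Baxter monoid and its involution\<close>

text \<open>Otherwise the simplifier turns \<open>lists {1..n}\<close> into statements about \<open>Suc 0\<close> and loses the
  closure lemmas below.\<close>

declare One_nat_def [simp del] in_lists_conv_set [simp del]

lemma baxt_cong_equiv: "equiv (lists {1..n}) (baxt_cong n)"
proof (rule equivI)
  show "baxt_cong n \<subseteq> lists {1..n} \<times> lists {1..n}"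
  proof (rule subrelI)
    fix u v assume "(u, v) \<in> baxt_cong n"
    from baxt_cong_lists[OF this] show "(u, v) \<in> lists {1..n} \<times> lists {1..n}" by simp
  qed
  show "refl_on (lists {1..n}) (baxt_cong n)" by (intro refl_onI baxt_cong.refl)
  show "sym (baxt_cong n)" by (rule symI) (rule baxt_cong.sym)
  show "trans (baxt_cong n)" by (intro transI) (rule baxt_cong.trans)
qed

lemma baxt_class_eq_iff:
  "u \<in> lists {1..n} \<Longrightarrow> v \<in> lists {1..n} \<Longrightarrow> baxt_class n u = baxt_class n v \<longleftrightarrow> (u, v) \<in> baxt_cong n"
  unfolding baxt_class_def by (rule eq_equiv_class_iff[OF baxt_cong_equiv])

lemma baxt_class_eqI: "(u, v) \<in> baxt_cong n \<Longrightarrow> baxt_class n u = baxt_class n v"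
  using baxt_class_eq_iff baxt_cong_lists by blast

lemma in_baxt_class_self: "w \<in> lists {1..n} \<Longrightarrow> w \<in> baxt_class n w"
  by (simp add: baxt_class_def baxt_cong.refl)

lemma in_baxt_class_iff: "v \<in> baxt_class n u \<longleftrightarrow> (u, v) \<in> baxt_cong n"
  by (simp add: baxt_class_def)

lemma baxt_carrier: "carrier (baxt n) = baxt_class n ` lists {1..n}"
  by (auto simp: baxt_def quotient_def baxt_class_def)

lemma baxt_one: "\<one>\<^bsub>baxt n\<^esub> = baxt_class n []"
  by (simp add: baxt_def)

text \<open>All classes in the union that defines the product coincide, because the congruence
  respects concatenation, and both index sets are non-empty.\<close>

lemma baxt_mult:
  assumes "u \<in> lists {1..n}" "v \<in> lists {1..n}"
  shows "baxt_class n u \<otimes>\<^bsub>baxt n\<^esub> baxt_class n v = baxt_class n (u @ v)"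
proof -
  have "baxt_class n (x @ y) = baxt_class n (u @ v)"
    if "x \<in> baxt_class n u" "y \<in> baxt_class n v" for x y
    using that by (intro baxt_class_eqI baxt_cong.mult) (simp_all add: in_baxt_class_iff baxt_cong.sym)
  then have "(\<Union>x\<in>baxt_class n u. \<Union>y\<in>baxt_class n v. baxt_class n (x @ y)) =
      (\<Union>x\<in>baxt_class n u. \<Union>y\<in>baxt_class n v. baxt_class n (u @ v))"
    by (intro SUP_cong[OF HOL.refl]) blast
  also have "\<dots> = baxt_class n (u @ v)"
    using in_baxt_class_self[OF assms(1)] in_baxt_class_self[OF assms(2)] by blast
  finally show ?thesis by (simp add: baxt_def)
qed

lemma baxt_monoid: "monoid (baxt n)"
proof (rule monoidI)
  show "\<one>\<^bsub>baxt n\<^esub> \<in> carrier (baxt n)" by (auto simp: baxt_carrier baxt_one)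
next
  fix X Y assume "X \<in> carrier (baxt n)" "Y \<in> carrier (baxt n)"
  then obtain u v where "u \<in> lists {1..n}" "v \<in> lists {1..n}"
    "X = baxt_class n u" "Y = baxt_class n v"
    unfolding baxt_carrier by blast
  then show "X \<otimes>\<^bsub>baxt n\<^esub> Y \<in> carrier (baxt n)"
    by (simp add: baxt_carrier baxt_mult)
next
  fix X Y Z assume "X \<in> carrier (baxt n)" "Y \<in> carrier (baxt n)" "Z \<in> carrier (baxt n)"
  then obtain u v w where "u \<in> lists {1..n}" "v \<in> lists {1..n}" "w \<in> lists {1..n}"
    "X = baxt_class n u" "Y = baxt_class n v" "Z = baxt_class n w"
    unfolding baxt_carrier by blast
  then show "X \<otimes>\<^bsub>baxt n\<^esub> Y \<otimes>\<^bsub>baxt n\<^esub> Z = X \<otimes>\<^bsub>baxt n\<^esub> (Y \<otimes>\<^bsub>baxt n\<^esub> Z)"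
    by (simp add: baxt_mult)
next
  fix X assume "X \<in> carrier (baxt n)"
  then obtain u where "u \<in> lists {1..n}" "X = baxt_class n u" unfolding baxt_carrier by blast
  then show "\<one>\<^bsub>baxt n\<^esub> \<otimes>\<^bsub>baxt n\<^esub> X = X" "X \<otimes>\<^bsub>baxt n\<^esub> \<one>\<^bsub>baxt n\<^esub> = X"
    using baxt_mult[of "[]" n u] baxt_mult[of u n "[]"] by (simp_all add: baxt_one)
qed

lemma sharp_closed: "k \<in> {1..n} \<Longrightarrow> sharp n k \<in> {1..n}"
  by (auto simp: sharp_def)

lemma sharp_sharp: "k \<in> {1..n} \<Longrightarrow> sharp n (sharp n k) = k"
  by (auto simp: sharp_def)

lemma word_sharp_simps [simp]:
  "word_sharp n [] = []" "word_sharp n (k # w) = word_sharp n w @ [sharp n k]"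
  "word_sharp n (u @ v) = word_sharp n v @ word_sharp n u"
  by (simp_all add: word_sharp_def)

lemma word_sharp_closed: "w \<in> lists {1..n} \<Longrightarrow> word_sharp n w \<in> lists {1..n}"
  using sharp_closed by (fastforce simp: word_sharp_def)

lemma word_sharp_word_sharp: "w \<in> lists {1..n} \<Longrightarrow> word_sharp n (word_sharp n w) = w"
  by (induction w) (simp_all add: sharp_sharp)

text \<open>Reversing and complementing turns each defining relation into an instance of the same
  relation, with \<open>sharp n d\<close>, \<open>sharp n c\<close>, \<open>sharp n b\<close>,
  \<open>sharp n a\<close> in the roles of \<open>a\<close>, \<open>b\<close>, \<open>c\<close>,
  \<open>d\<close>.\<close>

lemma word_sharp_baxt_cong:
  "(u, v) \<in> baxt_cong n \<Longrightarrow> (word_sharp n u, word_sharp n v) \<in> baxt_cong n"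
proof (induction rule: baxt_cong.induct)
  case (rel1 a b c d u v)
  have "([sharp n b] @ word_sharp n v @ [sharp n d, sharp n a] @ word_sharp n u @ [sharp n c],
    [sharp n b] @ word_sharp n v @ [sharp n a, sharp n d] @ word_sharp n u @ [sharp n c]) \<in> baxt_cong n"
    using rel1 word_sharp_closed[of u n] word_sharp_closed[of v n]
    by (intro baxt_cong.rel1) (auto simp: sharp_def)
  then show ?case by simp
next
  case (rel2 a b c d u v)
  have "([sharp n c] @ word_sharp n v @ [sharp n a, sharp n d] @ word_sharp n u @ [sharp n b],
    [sharp n c] @ word_sharp n v @ [sharp n d, sharp n a] @ word_sharp n u @ [sharp n b]) \<in> baxt_cong n"
    using rel2 word_sharp_closed[of u n] word_sharp_closed[of v n]
    by (intro baxt_cong.rel2) (auto simp: sharp_def)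
  then show ?case by simp
next
  case (refl w)
  then show ?case by (intro baxt_cong.refl word_sharp_closed)
next
  case (mult u v u' v')
  then show ?case by (simp add: baxt_cong.mult)
qed (auto intro: baxt_cong.sym baxt_cong.trans)

lemma baxt_sharp_class:
  assumes "w \<in> lists {1..n}"
  shows "baxt_sharp n (baxt_class n w) = baxt_class n (word_sharp n w)"
proof -
  have "baxt_class n (word_sharp n x) = baxt_class n (word_sharp n w)" if "x \<in> baxt_class n w" for x
    using that by (intro baxt_class_eqI word_sharp_baxt_cong) (simp add: in_baxt_class_iff baxt_cong.sym)
  then have "(\<Union>x\<in>baxt_class n w. baxt_class n (word_sharp n x)) =
      (\<Union>x\<in>baxt_class n w. baxt_class n (word_sharp n w))"
    by (intro SUP_cong[OF HOL.refl]) blast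
  also have "\<dots> = baxt_class n (word_sharp n w)"
    using in_baxt_class_self[OF assms] by blast
  finally show ?thesis by (simp add: baxt_sharp_def)
qed

lemma baxt_involution_monoid: "involution_monoid (baxt n) (baxt_sharp n)"
proof -
  interpret monoid "baxt n" by (rule baxt_monoid)
  show ?thesis
  proof
    fix X assume "X \<in> carrier (baxt n)"
    then obtain u where u: "u \<in> lists {1..n}" "X = baxt_class n u" unfolding baxt_carrier by blast
    with word_sharp_closed[of u n] show "baxt_sharp n X \<in> carrier (baxt n)"
      "baxt_sharp n (baxt_sharp n X) = X"
      by (simp_all add: baxt_carrier baxt_sharp_class word_sharp_word_sharp)
    fix Y assume "Y \<in> carrier (baxt n)"
    then obtain v where v: "v \<in> lists {1..n}" "Y = baxt_class n v" unfolding baxt_carrier by blast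
    with u word_sharp_closed[of u n] word_sharp_closed[of v n]
    show "baxt_sharp n (X \<otimes>\<^bsub>baxt n\<^esub> Y) = baxt_sharp n Y \<otimes>\<^bsub>baxt n\<^esub> baxt_sharp n X"
      by (simp add: baxt_mult baxt_sharp_class)
  qed
qed

lemma word_hom_baxt:
  assumes "\<And>k. f k \<in> lists {1..n}"
  shows "word_hom (baxt n) (\<lambda>k. baxt_class n (f k)) w = baxt_class n (concat (map f w))"
proof (induction w)
  case (Cons k w)
  have "concat (map f w) \<in> lists {1..n}" by (induction w) (simp_all add: assms)
  with Cons show ?case by (simp add: word_hom_Cons baxt_mult assms)
qed (simp add: baxt_one)

subsection \<open>The representation of rank three\<close>

text \<open>Closed form of the product along \<open>w\<close> when \<open>p\<close> is sent to
  \<open>mat_P s\<close>, each letter of \<open>{p<..q}\<close> to \<open>mat_K\<close> and all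
  others to the identity. Powers of P count the letters \<open>p\<close>; since K X = K for each of
  these matrices X, all that follows the first K is forgotten.\<close>

definition left_block :: "'a::comm_semiring_1 \<Rightarrow> nat \<Rightarrow> nat \<Rightarrow> nat list \<Rightarrow> 'a mat" where
  "left_block s p q w = (if set w \<inter> {p<..q} = {} then mat2 (s ^ count_list w p) 0 0 1
                         else mat2 0 (s ^ lcount p q w) 0 1)"

text \<open>The mirror image: \<open>q\<close> is sent to \<open>mat_Q s\<close>, each letter of
  \<open>{p..<q}\<close> to \<open>mat_J\<close>, and X J = J forgets all that precedes the last
  J.\<close>

definition right_block :: "'a::comm_semiring_1 \<Rightarrow> nat \<Rightarrow> nat \<Rightarrow> nat list \<Rightarrow> 'a mat" where
  "right_block s p q w = (if set w \<inter> {p..<q} = {} then mat2 1 0 0 (s ^ count_list w q)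
                          else mat2 1 (s ^ rcount p q w) 0 0)"

lemma left_block_Cons:
  "p < q \<Longrightarrow> left_block s p q (k # w) = left_block s p q [k] * left_block s p q w"
  by (auto simp: left_block_def mat2_mult lcount_Cons power_add mult.commute)

lemma right_block_Cons:
  "p < q \<Longrightarrow> right_block s p q (k # w) = right_block s p q [k] * right_block s p q w"
  by (auto simp: right_block_def mat2_mult rcount_Cons power_add mult.commute)

lemma dim_blocks [simp]:
  "dim_row (left_block s p q w) = 2" "dim_col (left_block s p q w) = 2"
  "dim_row (right_block s p q w) = 2" "dim_col (right_block s p q w) = 2"
  by (simp_all add: left_block_def right_block_def)

text \<open>Three blocks of size one and six of size two give dimension 15. In this order
  \<open>left_block s p q\<close> sits opposite \<open>right_block s (4 - q) (4 - p)\<close>, as the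
  involution demands.\<close>

definition phi3_blocks :: "'a::comm_semiring_1 \<Rightarrow> nat list \<Rightarrow> 'a mat list" where
  "phi3_blocks s w =
    [mat_scalar (s ^ count_list w 1), left_block s 1 3 w, left_block s 1 2 w, left_block s 2 3 w,
     mat_scalar (s ^ count_list w 2), right_block s 1 2 w, right_block s 2 3 w, right_block s 1 3 w,
     mat_scalar (s ^ count_list w 3)]"

lemma phi3_letter_blocks:
  "k \<in> {1..3} \<Longrightarrow> phi3_letter s k = diag_block_mat (phi3_blocks s [k])"
proof -
  assume "k \<in> {1..3}"
  then consider "k = 1" | "k = 2" | "k = 3" by fastforce
  then show ?thesis
    unfolding phi3_letter_def phi3_blocks_def left_block_def right_block_def one_mat2 mat_P_def mat_Q_def
      mat_J_def mat_K_def mat2_def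
    by cases (simp_all add: lcount_Cons rcount_Cons)
qed

lemma one_mat_15: "(1\<^sub>m 15 :: 'a::comm_semiring_1 mat) = diag_block_mat (phi3_blocks s [])"
proof -
  have "(1\<^sub>m 15 :: 'a mat) = diag_block_mat (map (\<lambda>A. 1\<^sub>m (dim_row A)) (phi3_blocks s []))"
    unfolding diag_block_one_mat by (simp add: phi3_blocks_def del: diag_block_mat.simps)
  then show ?thesis
    by (simp add: phi3_blocks_def left_block_def right_block_def one_mat2 one_mat_scalar[unfolded One_nat_def]
        del: diag_block_mat.simps)
qed

lemma phi3_blocks_Cons:
  "map2 (*) (phi3_blocks s [k]) (phi3_blocks s w) = phi3_blocks s (k # w)"
  by (simp add: phi3_blocks_def left_block_Cons[of _ _ _ k w] right_block_Cons[of _ _ _ k w] mat_scalar_mult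
      power_add mult.commute)

definition phi3_word :: "'a::comm_semiring_1 \<Rightarrow> nat list \<Rightarrow> 'a mat" where
  "phi3_word s w = word_hom (UT 15) (phi3_letter s) w"

lemma phi3_word_eq_diag_block_mat:
  "w \<in> lists {1..3} \<Longrightarrow> phi3_word s w = diag_block_mat (phi3_blocks s w)"
proof (induction w)
  case Nil
  show ?case using one_mat_15 by (simp add: phi3_word_def)
next
  case (Cons k w)
  then have "phi3_word s (k # w) = diag_block_mat (phi3_blocks s [k]) * diag_block_mat (phi3_blocks s w)"
    by (simp add: phi3_word_def word_hom_Cons phi3_letter_blocks)
  also have "\<dots> = diag_block_mat (map2 (*) (phi3_blocks s [k]) (phi3_blocks s w))"
    by (rule diag_block_mat_mult) (simp add: phi3_blocks_def)
  finally show ?case by (simp only: phi3_blocks_Cons)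
qed

lemma UT_word_append:
  assumes "\<And>k. k \<in> set (u @ v) \<Longrightarrow> f k \<in> carrier (UT m)"
  shows "word_hom (UT m) f (u @ v) = word_hom (UT m) f u * word_hom (UT m) f v"
  using monoid.word_hom_append[OF UT_monoid assms] by simp

lemma block_upper_triangular:
  "\<exists>a b d. left_block s p q w = mat2 a b 0 d" "\<exists>a b d. right_block s p q w = mat2 a b 0 d"
  unfolding left_block_def right_block_def by (cases "set w \<inter> {p<..q} = {}"; auto)
    (cases "set w \<inter> {p..<q} = {}"; auto)

lemma phi3_letter_UT:
  assumes "k \<in> {1..3}"
  shows "phi3_letter s k \<in> carrier (UT 15)"
proof -
  let ?D = "diag_block_mat (phi3_blocks s [k])"
  have sq: "Ball (set (phi3_blocks s [k])) square_mat" by (simp add: phi3_blocks_def)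
  have d: "dim_row ?D = 15" by (simp add: dim_diag_block_mat phi3_blocks_def)
  then have "?D \<in> carrier_mat 15 15" using diag_block_mat_square[OF sq] by auto
  moreover have "upper_triangular ?D"
  proof
    fix i j assume ij: "j < i" "i < dim_row ?D"
    show "?D $$ (i, j) = 0"
    proof (rule diag_block_upper_triangular[OF _ sq ij])
      fix A i j assume A: "A \<in> set (phi3_blocks s [k])" "j < i" "i < dim_row A"
      then have "(\<exists>x. A = mat_scalar x) \<or> (\<exists>a b d. A = mat2 a b 0 d)"
        using block_upper_triangular unfolding phi3_blocks_def list.set insert_iff empty_iff by metis
      then show "A $$ (i, j) = 0"
      proof
        assume "\<exists>x. A = mat_scalar x"
        then show ?thesis using A by auto
      next
        assume "\<exists>a b d. A = mat2 a b 0 d"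
        then obtain a b d where m: "A = mat2 a b 0 d" by blast
        then have "i = Suc 0" "j = 0" using A by simp_all
        then show ?thesis using m by simp
      qed
    qed
  qed
  ultimately show ?thesis unfolding phi3_letter_blocks[OF assms] by simp
qed

lemma phi3_word_UT: "w \<in> lists {1..3} \<Longrightarrow> phi3_word s w \<in> carrier (UT 15)"
  unfolding phi3_word_def
  by (intro monoid.word_hom_closed[OF UT_monoid] phi3_letter_UT) (auto simp: in_lists_conv_set)

lemma phi3_word_carrier: "w \<in> lists {1..3} \<Longrightarrow> phi3_word s w \<in> carrier_mat 15 15"
  using phi3_word_UT[of w s] by simp

lemma phi3_word_append:
  "u \<in> lists {1..3} \<Longrightarrow> v \<in> lists {1..3} \<Longrightarrow> phi3_word s (u @ v) = phi3_word s u * phi3_word s v"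
  unfolding phi3_word_def
  by (intro UT_word_append phi3_letter_UT) (auto simp: in_lists_conv_set)

lemma left_block_cong:
  assumes "same_invariants n u v" "1 \<le> p" "p < q" "q \<le> n"
  shows "left_block s p q u = left_block s p q v"
  using assms unfolding same_invariants_def left_block_def
  by (metis count_list_eq_if_mset_eq set_mset_mset)

lemma right_block_cong:
  assumes "same_invariants n u v" "1 \<le> p" "p < q" "q \<le> n"
  shows "right_block s p q u = right_block s p q v"
  using assms unfolding same_invariants_def right_block_def
  by (metis count_list_eq_if_mset_eq set_mset_mset)

text \<open>This makes \<open>phi3\<close> well defined: the content decides which shape each block
  has, and the exponents in it are invariants.\<close>

lemma phi3_word_cong:
  assumes "(u, v) \<in> baxt_cong 3"
  shows "phi3_word s u = phi3_word s v"
proof -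
  have inv: "same_invariants 3 u v" using assms by (rule baxt_cong_same_invariants)
  then have "mset u = mset v" by (simp add: same_invariants_def)
  note c = count_list_eq_if_mset_eq[OF this]
  have "phi3_blocks s u = phi3_blocks s v"
    unfolding phi3_blocks_def
    by (simp add: left_block_cong[OF inv] right_block_cong[OF inv] c)
  then show ?thesis
    using baxt_cong_lists[OF assms] by (simp add: phi3_word_eq_diag_block_mat)
qed

text \<open>The word map is constant on the class, which contains \<open>w\<close>, so
  \<open>the_elem\<close> is applied to a singleton.\<close>

lemma phi3_baxt_class:
  assumes "w \<in> lists {1..3}"
  shows "phi3 s (baxt_class 3 w) = phi3_word s w"
proof -
  have "phi3_word s ` baxt_class 3 w = (\<lambda>_. phi3_word s w) ` baxt_class 3 w"
    by (rule image_cong[OF HOL.refl]) (simp add: in_baxt_class_iff phi3_word_cong[of w])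
  also have "\<dots> = {phi3_word s w}" using in_baxt_class_self[OF assms] by blast
  finally have "phi3_word s ` baxt_class 3 w = {phi3_word s w}" .
  then show ?thesis unfolding phi3_def phi3_word_def[symmetric] by simp
qed

text \<open>Skew transposition interchanges \<open>mat_P s\<close> with \<open>mat_Q s\<close> and
  \<open>mat_K\<close> with \<open>mat_J\<close>; together with the reversed block order this is the
  effect of complementing the letter.\<close>

lemma skew_transpose_phi3_letter:
  assumes "k \<in> {1..3}"
  shows "skew_transpose (phi3_letter s k) = phi3_letter s (sharp 3 k)"
proof -
  consider "k = 1" | "k = 2" | "k = 3" using assms by fastforce
  then have "rev (map skew_transpose (phi3_blocks s [k])) = phi3_blocks s [sharp 3 k]"
    unfolding phi3_blocks_def left_block_def right_block_def
    by cases (simp_all add: lcount_Cons rcount_Cons skew_transpose_mat2 skew_transpose_mat_scalar sharp_def)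
  moreover have "skew_transpose (diag_block_mat (phi3_blocks s [k])) =
      diag_block_mat (rev (map skew_transpose (phi3_blocks s [k])))"
    by (rule skew_transpose_diag_block_mat) (auto simp: phi3_blocks_def)
  ultimately show ?thesis
    by (simp add: phi3_letter_blocks[OF assms] phi3_letter_blocks[OF sharp_closed[OF assms]])
qed

lemma phi3_word_sharp:
  fixes s :: "'a::comm_semiring_1"
  shows "w \<in> lists {1..3} \<Longrightarrow> phi3_word s (word_sharp 3 w) = skew_transpose (phi3_word s w)"
proof (induction w)
  case Nil
  have "skew_transpose (1\<^sub>m 15) = (1\<^sub>m 15 :: 'a mat)"
    by (rule eq_matI) (auto simp: skew_transpose_def)
  then show ?case by (simp add: phi3_word_def)
next
  case (Cons k w)
  then have k: "k \<in> {1..3}" and w: "w \<in> lists {1..3}" by auto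
  have sing: "phi3_word s [j] = phi3_letter s j" if "j \<in> {1..3}" for j
    using phi3_letter_UT[OF that, of s] by (auto simp: phi3_word_def word_hom_Cons intro!: right_mult_one_mat)
  have "phi3_word s (word_sharp 3 (k # w)) = phi3_word s (word_sharp 3 w) * phi3_word s [sharp 3 k]"
    using phi3_word_append[OF word_sharp_closed[OF w], of "[sharp 3 k]" s] sharp_closed[OF k] by simp
  also have "\<dots> = skew_transpose (phi3_word s w) * skew_transpose (phi3_letter s k)"
    using Cons.IH[OF w] by (simp add: sing[OF sharp_closed[OF k]] skew_transpose_phi3_letter[OF k])
  also have "\<dots> = skew_transpose (phi3_letter s k * phi3_word s w)"
    using phi3_letter_UT[OF k] phi3_word_carrier[OF w]
    by (intro skew_transpose_mult[symmetric, of _ 15]) auto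
  finally show ?case by (simp add: phi3_word_def word_hom_Cons)
qed

section \<open>Recovering the invariants from the matrices\<close>

lemma power_infinite_order_neq_0:
  fixes s :: "'a::comm_semiring_1"
  assumes "\<And>i j::nat. s ^ i = s ^ j \<longleftrightarrow> i = j"
  shows "s ^ k \<noteq> 0"
proof
  assume "s ^ k = 0"
  then have "s ^ Suc k = s ^ k" by simp
  then show False using assms[of "Suc k" k] by simp
qed

lemma lcount_no_stop: "set w \<inter> {p<..q} = {} \<Longrightarrow> lcount p q w = count_list w p"
  using lcount_append[of p q w "[]"] by simp

lemma rcount_no_stop: "set w \<inter> {p..<q} = {} \<Longrightarrow> rcount p q w = count_list w q"
  using rcount_append[of p q "[]" w] by simp

text \<open>The top left entry tells the two shapes apart, as no power of \<open>s\<close> is zero.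
  In both shapes the relevant exponent is \<open>lcount p q\<close>, which is the plain count when
  no stopping letter occurs.\<close>

lemma left_block_inject:
  assumes inf: "\<And>i j::nat. s ^ i = s ^ j \<longleftrightarrow> i = j"
    and eq: "left_block s p q u = left_block s p q v"
  shows "lcount p q u = lcount p q v"
  using eq power_infinite_order_neq_0[OF inf] lcount_no_stop[of u p q] lcount_no_stop[of v p q]
  by (auto simp: left_block_def inf split: if_splits)

lemma right_block_inject:
  assumes inf: "\<And>i j::nat. s ^ i = s ^ j \<longleftrightarrow> i = j"
    and eq: "right_block s p q u = right_block s p q v"
  shows "rcount p q u = rcount p q v"
  using eq power_infinite_order_neq_0[OF inf] rcount_no_stop[of u p q] rcount_no_stop[of v p q]
  by (auto simp: right_block_def inf split: if_splits)

lemma phi3_word_inject: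
  assumes inf: "\<And>i j::nat. s ^ i = s ^ j \<longleftrightarrow> i = j"
    and w: "u \<in> lists {1..3}" "v \<in> lists {1..3}"
    and eq: "phi3_word s u = phi3_word s v"
    and ab: "1 \<le> a" "a < b" "b \<le> 3"
  shows "count_list u a = count_list v a" "count_list u b = count_list v b"
    "lcount a b u = lcount a b v" "rcount a b u = rcount a b v"
proof -
  have "phi3_blocks s u = phi3_blocks s v"
  proof (rule diag_block_mat_inject)
    show "diag_block_mat (phi3_blocks s u) = diag_block_mat (phi3_blocks s v)"
      using eq w by (simp add: phi3_word_eq_diag_block_mat)
  qed (simp add: phi3_blocks_def)
  note blocks = this[unfolded phi3_blocks_def, simplified]
  consider "a = 1" "b = 2" | "a = 1" "b = 3" | "a = 2" "b = 3" using ab by linarith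
  then have "count_list u a = count_list v a \<and> count_list u b = count_list v b \<and>
    left_block s a b u = left_block s a b v \<and> right_block s a b u = right_block s a b v"
    using blocks by cases (simp_all add: inf)
  then show "count_list u a = count_list v a" "count_list u b = count_list v b"
    "lcount a b u = lcount a b v" "rcount a b u = rcount a b v"
    using left_block_inject[OF inf] right_block_inject[OF inf] by blast+
qed

subsection \<open>Substitutions into three letters\<close>

lemma span_letter_closed: "g \<in> {1..n} \<Longrightarrow> h \<in> {1..n} \<Longrightarrow> span_letter p q g h k \<in> lists {1..n}"
  by (simp add: span_letter_def)

lemma concat_map_closed: "(\<And>k. f k \<in> lists X) \<Longrightarrow> concat (map f w) \<in> lists X"
  by (induction w) simp_all

text \<open>The listed words are the non-empty images under a span substitution. A single exchange
  of \<open>g\<close> and \<open>h\<close> is permitted by the \<open>h\<close> in front and the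
  \<open>g\<close> behind, and one such exchange settles each pair of distinct images.\<close>

lemma baxt_cong_commute_letters:
  assumes "x \<in> lists {1..n}" "y \<in> lists {1..n}" and gh: "g < h" and "h \<in> set x" "g \<in> set y"
    and m: "m \<in> {[g], [h], [h, g]}" "m' \<in> {[g], [h], [h, g]}"
  shows "(x @ m @ m' @ y, x @ m' @ m @ y) \<in> baxt_cong n"
proof -
  have g: "g \<in> {1..n}" and h: "h \<in> {1..n}" using assms by (auto simp: in_lists_conv_set)
  have swap: "(x' @ g # h # y', x' @ h # g # y') \<in> baxt_cong n"
    if "x' \<in> lists {1..n}" "y' \<in> lists {1..n}" "h \<in> set x'" "g \<in> set y'" for x' y'
  proof (rule baxt_cong_swap[OF _ gh])
    show "x' @ g # h # y' \<in> lists {1..n}" using that g h by simp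
    show "set x' \<inter> {g<..h} \<noteq> {}" "set y' \<inter> {g..<h} \<noteq> {}" using that gh by auto
  qed
  \<comment> \<open>In turn these treat \<open>[g]\<close> with \<open>[h]\<close>,
    \<open>[g]\<close> with \<open>[h, g]\<close>, and \<open>[h, g]\<close> with
    \<open>[h]\<close>; equal images are covered by reflexivity.\<close>
  note s1 = swap[of x y] swap[of x "g # y"] swap[of "x @ [h]" y]
  show ?thesis
    using m s1[THEN baxt_cong.sym] s1 assms(1,2,4,5) g h
      baxt_cong.refl[of "x @ m @ m' @ y" n]
    by auto
qed

text \<open>This makes the substitutions well defined on classes. If the exchanged letters
  \<open>a < d\<close> both have non-empty images, then \<open>p \<le> a\<close> and
  \<open>d \<le> q\<close>; so the outer letter in front lies in \<open>{p<..q}\<close> and its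
  image contains \<open>h\<close>, the one behind lies in \<open>{p..<q}\<close> and its image
  contains \<open>g\<close>.\<close>

lemma span_baxt_cong:
  assumes "(u, v) \<in> baxt_cong n" and pq: "p < q" and gh: "1 \<le> g" "g < h" "h \<le> m"
  shows "(concat (map (span_letter p q g h) u), concat (map (span_letter p q g h) v)) \<in> baxt_cong m"
proof -
  let ?f = "span_letter p q g h"
  let ?F = "\<lambda>w. concat (map ?f w)"
  have letters: "g \<in> {1..m}" "h \<in> {1..m}" using gh by auto
  have F: "?F w \<in> lists {1..m}" for w
    by (rule concat_map_closed) (rule span_letter_closed[OF letters])
  have f: "?f k \<in> lists {1..m}" for k by (rule span_letter_closed[OF letters])
  have commute: "(x @ ?f a @ ?f d @ y, x @ ?f d @ ?f a @ y) \<in> baxt_cong m"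
    if "x \<in> lists {1..m}" "y \<in> lists {1..m}"
      "p \<le> a \<Longrightarrow> d \<le> q \<Longrightarrow> h \<in> set x" "p \<le> a \<Longrightarrow> d \<le> q \<Longrightarrow> g \<in> set y" "a < d" for x y a d
  proof (cases "?f a = [] \<or> ?f d = []")
    case True
    then show ?thesis using that f baxt_cong.refl[of "x @ ?f a @ ?f d @ y" m] by auto
  next
    case False
    then have "p \<le> a" "d \<le> q" using \<open>a < d\<close> pq by (auto simp: span_letter_def split: if_splits)
    then show ?thesis using that False gh
      by (intro baxt_cong_commute_letters[of x m y g h]) (auto simp: span_letter_def split: if_splits)
  qed
  from assms(1) show ?thesis
  proof induction
    case (rel1 a b c d u v)
    have "((?f c @ ?F u) @ ?f a @ ?f d @ (?F v @ ?f b), (?f c @ ?F u) @ ?f d @ ?f a @ (?F v @ ?f b)) \<in> baxt_cong m"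
    proof (rule commute)
      show "?f c @ ?F u \<in> lists {1..m}" "?F v @ ?f b \<in> lists {1..m}" by (simp_all add: F f)
      show "h \<in> set (?f c @ ?F u)" "g \<in> set (?F v @ ?f b)" if "p \<le> a" "d \<le> q"
        using that rel1.hyps by (simp_all add: span_letter_def)
      show "a < d" using rel1.hyps by linarith
    qed
    then show ?case by simp
  next
    case (rel2 a b c d u v)
    have "((?f b @ ?F u) @ ?f a @ ?f d @ (?F v @ ?f c), (?f b @ ?F u) @ ?f d @ ?f a @ (?F v @ ?f c)) \<in> baxt_cong m"
    proof (rule commute)
      show "?f b @ ?F u \<in> lists {1..m}" "?F v @ ?f c \<in> lists {1..m}" by (simp_all add: F f)
      show "h \<in> set (?f b @ ?F u)" "g \<in> set (?F v @ ?f c)" if "p \<le> a" "d \<le> q"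
        using that rel2.hyps by (simp_all add: span_letter_def)
      show "a < d" using rel2.hyps by linarith
    qed
    from baxt_cong.sym[OF this] show ?case by simp
  next
    case (refl w)
    show ?case by (rule baxt_cong.refl) (rule F)
  next
    case (mult u v u' v')
    then show ?case by (simp add: baxt_cong.mult)
  next
    case (sym u v)
    show ?case by (rule baxt_cong.sym) fact
  next
    case (trans u v w)
    show ?case by (rule baxt_cong.trans) fact+
  qed
qed

text \<open>Letters of \<open>{p<..q}\<close> have images starting with \<open>h\<close>, which stop
  the count at once, and the only other non-empty image is the \<open>[g]\<close> of
  \<open>p\<close>. Hence the order \<open>[b, a]\<close> in \<open>span_letter\<close>.\<close>

lemma lcount_span:
  assumes "p < q" "g < h"
  shows "lcount g h (concat (map (span_letter p q g h) w)) = lcount p q w"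
proof (induction w)
  case (Cons k w)
  then show ?case using assms by (simp add: lcount_Cons span_letter_def)
qed simp

lemma span_letter_disjoint_iff:
  assumes "p < q" "g < h"
  shows "set (span_letter p q g h k) \<inter> {g..<h} = {} \<longleftrightarrow> k \<notin> {p..<q}"
  using assms by (auto simp: span_letter_def)

lemma span_disjoint_iff:
  assumes "p < q" "g < h"
  shows "set (concat (map (span_letter p q g h) w)) \<inter> {g..<h} = {} \<longleftrightarrow> set w \<inter> {p..<q} = {}"
  using span_letter_disjoint_iff[OF assms] by (induction w) (simp_all add: Int_Un_distrib2)

lemma count_span_upper:
  assumes "p < q" "g < h" "set w \<inter> {p..<q} = {}"
  shows "count_list (concat (map (span_letter p q g h) w)) h = count_list w q"
  using assms by (induction w) (auto simp: span_letter_def)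

text \<open>Letters of \<open>{p..<q}\<close> have images ending in \<open>g\<close>, so from the
  right the count stops before the \<open>h\<close> of \<open>[h, g]\<close> is reached.\<close>

lemma rcount_span:
  assumes "p < q" "g < h"
  shows "rcount g h (concat (map (span_letter p q g h) w)) = rcount p q w"
proof (induction w)
  case (Cons k w)
  have "rcount g h (span_letter p q g h k) = (if k = q then 1 else 0)"
    using assms by (simp add: span_letter_def rcount_Cons)
  then show ?case
    using Cons span_disjoint_iff[OF assms, of w] count_span_upper[OF assms, of w]
    by (simp add: rcount_append rcount_Cons)
qed simp

text \<open>No letter lies strictly between \<open>p\<close> and \<open>Suc p\<close>, so plain
  counts survive too. Adjacent pairs thus determine the content of a word, whereas in wider spans
  the images \<open>[h, g]\<close> add to both counts.\<close>

lemma count_span_Suc: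
  assumes "g < h"
  shows "count_list (concat (map (span_letter p (Suc p) g h) w)) g = count_list w p"
    and "count_list (concat (map (span_letter p (Suc p) g h) w)) h = count_list w (Suc p)"
  using assms by (induction w) (auto simp: span_letter_def)

section \<open>The substitutions on words and their exchange under the involution\<close>

definition alpha_span :: "nat \<Rightarrow> nat \<Rightarrow> nat \<Rightarrow> nat \<Rightarrow> nat list" where
  "alpha_span n i j = (if sharp n i = j then span_letter i j 1 3
     else case pq n i j of (p, q) \<Rightarrow> span_letter p q 1 2)"

definition beta_span :: "nat \<Rightarrow> nat \<Rightarrow> nat \<Rightarrow> nat \<Rightarrow> nat list" where
  "beta_span n i j = (if sharp n i = j then span_letter i j 1 3
     else case pq n i j of (p, q) \<Rightarrow> span_letter (sharp n q) (sharp n p) 2 3)"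

lemma pq_less:
  assumes "(i, j) \<in> index_pairs n" "pq n i j = (p, q)"
  shows "p < q" "sharp n q < sharp n p"
  using assms by (auto simp: index_pairs_def pq_def sharp_def split: if_splits)

lemma alpha_span_cases:
  assumes "(i, j) \<in> index_pairs n"
  obtains p q g h where "p < q" "1 \<le> g" "g < h" "h \<le> 3" "alpha_span n i j = span_letter p q g h"
proof (cases "sharp n i = j")
  case True
  then show ?thesis using assms
    by (intro that[of i j 1 3]) (simp_all add: alpha_span_def index_pairs_def)
next
  case False
  obtain p q where "pq n i j = (p, q)" by fastforce
  with False show ?thesis using pq_less[OF assms]
    by (intro that[of p q 1 2]) (simp_all add: alpha_span_def)
qed

lemma beta_span_cases:
  assumes "(i, j) \<in> index_pairs n"
  obtains p q g h where "p < q" "1 \<le> g" "g < h" "h \<le> 3" "beta_span n i j = span_letter p q g h"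
proof (cases "sharp n i = j")
  case True
  then show ?thesis using assms
    by (intro that[of i j 1 3]) (simp_all add: beta_span_def index_pairs_def)
next
  case False
  obtain p q where "pq n i j = (p, q)" by fastforce
  with False show ?thesis using pq_less[OF assms]
    by (intro that[of "sharp n q" "sharp n p" 2 3]) (simp_all add: beta_span_def)
qed

lemma alpha_span_closed: "alpha_span n i j k \<in> lists {1..3}"
  by (simp add: alpha_span_def span_letter_closed split_beta)

lemma beta_span_closed: "beta_span n i j k \<in> lists {1..3}"
  by (simp add: beta_span_def span_letter_closed split_beta)

text \<open>For \<open>q \<le> sharp n p\<close> the pair is spanned by alpha directly. Otherwise
  \<open>pq\<close> reflects it, and the reflection in the definition of beta undoes this.\<close>

lemma index_pair_span:
  assumes "(p, q) \<in> index_pairs n"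
  shows "\<exists>g h. 1 \<le> g \<and> g < h \<and> h \<le> 3 \<and>
    (alpha_span n p q = span_letter p q g h \<or> beta_span n p q = span_letter p q g h)"
proof -
  have pq: "1 \<le> p" "p < q" "q \<le> n" using assms by (auto simp: index_pairs_def)
  consider "sharp n p = q" | "q < sharp n p" | "sharp n p < q" by linarith
  then show ?thesis
  proof cases
    case 1
    then show ?thesis by (intro exI[of _ 1] exI[of _ 3]) (simp add: alpha_span_def)
  next
    case 2
    then show ?thesis by (intro exI[of _ 1] exI[of _ 2]) (simp add: alpha_span_def pq_def)
  next
    case 3
    then show ?thesis using pq
      by (intro exI[of _ 2] exI[of _ 3]) (simp add: beta_span_def pq_def sharp_sharp)
  qed
qed

text \<open>Complementing maps the interval from \<open>p\<close> to \<open>q\<close> onto that from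
  \<open>sharp n q\<close> to \<open>sharp n p\<close> with end points exchanged, and
  \<open>word_sharp m\<close> takes \<open>[sharp m g, sharp m h]\<close> to \<open>[h, g]\<close>,
  the image of an interior letter.\<close>

lemma span_letter_sharp:
  assumes p: "p \<in> {1..n}" and q: "q \<in> {1..n}" and k: "k \<in> {1..n}" and "p < q"
    and gh: "g \<in> {1..m}" "h \<in> {1..m}"
  shows "span_letter p q g h (sharp n k) =
    word_sharp m (span_letter (sharp n q) (sharp n p) (sharp m h) (sharp m g) k)"
proof -
  have "sharp n k = p \<longleftrightarrow> k = sharp n p" "sharp n k = q \<longleftrightarrow> k = sharp n q"
    using p q k sharp_sharp by metis+
  moreover have "p < sharp n k \<and> sharp n k < q \<longleftrightarrow> sharp n q < k \<and> k < sharp n p"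
    using p q k unfolding sharp_def atLeastAtMost_iff by linarith
  moreover have "sharp n p \<noteq> sharp n q" using p q \<open>p < q\<close> sharp_sharp by (metis less_irrefl)
  ultimately show ?thesis by (simp add: span_letter_def sharp_sharp[OF gh(1)] sharp_sharp[OF gh(2)])
qed

text \<open>Complementing three letters takes the letters 1, 2 used by alpha to the letters 3, 2
  used by beta, and exchanges 1 and 3 in the symmetric case, where both substitutions agree.\<close>

lemma alpha_span_sharp:
  assumes ij: "(i, j) \<in> index_pairs n" and k: "k \<in> {1..n}"
  shows "alpha_span n i j (sharp n k) = word_sharp 3 (beta_span n i j k)"
proof (cases "sharp n i = j")
  case True
  have r: "i \<in> {1..n}" "j \<in> {1..n}" "i < j" using ij by (auto simp: index_pairs_def)
  then have "sharp n j = i" using True sharp_sharp by blast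
  moreover have "sharp 3 3 = 1" "sharp 3 1 = 3" by (simp_all add: sharp_def)
  ultimately show ?thesis
    using span_letter_sharp[OF r(1,2) k r(3), of 1 3 3] True
    by (simp add: alpha_span_def beta_span_def)
next
  case False
  obtain p q where pq: "pq n i j = (p, q)" by fastforce
  have "i \<in> {1..n}" "j \<in> {1..n}" using ij by (auto simp: index_pairs_def)
  then have "p \<in> {1..n}" "q \<in> {1..n}"
    using pq sharp_closed[of i n] sharp_closed[of j n] by (auto simp: pq_def split: if_splits)
  moreover have "sharp 3 2 = 2" "sharp 3 1 = 3" by (simp_all add: sharp_def)
  ultimately show ?thesis
    using span_letter_sharp[OF _ _ k pq_less(1)[OF ij pq], of 1 3 2] False pq
    by (simp add: alpha_span_def beta_span_def)
qed

lemma concat_map_sharp: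
  assumes "\<And>k. k \<in> {1..n} \<Longrightarrow> f (sharp n k) = word_sharp m (f' k)" "w \<in> lists {1..n}"
  shows "concat (map f (word_sharp n w)) = word_sharp m (concat (map f' w))"
  using assms(2) by (induction w) (simp_all add: assms(1))

lemma beta_span_sharp:
  assumes "(i, j) \<in> index_pairs n" "k \<in> {1..n}"
  shows "beta_span n i j (sharp n k) = word_sharp 3 (alpha_span n i j k)"
  using alpha_span_sharp[OF assms(1) sharp_closed[OF assms(2)]] assms(2) beta_span_closed
  by (simp add: sharp_sharp word_sharp_word_sharp)

text \<open>Computing with the representing words \<open>alpha_span\<close> replaces products of
  classes by concatenation.\<close>

lemma alpha_eq: "alpha n i j w = baxt_class 3 (concat (map (alpha_span n i j) w))"
proof -
  have "alpha_letter n i j = (\<lambda>k. baxt_class 3 (alpha_span n i j k))"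
    by (rule ext) (simp add: alpha_letter_def alpha_span_def split: prod.split)
  then show ?thesis by (simp add: alpha_def word_hom_baxt alpha_span_closed)
qed

lemma beta_eq: "beta n i j w = baxt_class 3 (concat (map (beta_span n i j) w))"
proof -
  have "beta_letter n i j = (\<lambda>k. baxt_class 3 (beta_span n i j k))"
    by (rule ext) (simp add: beta_letter_def beta_span_def split: prod.split)
  then show ?thesis by (simp add: beta_def word_hom_baxt beta_span_closed)
qed

section \<open>The block diagonal matrix of a word\<close>

definition alpha_rep :: "'a::comm_semiring_1 \<Rightarrow> nat \<Rightarrow> nat list \<Rightarrow> nat \<times> nat \<Rightarrow> 'a mat" where
  "alpha_rep s n w = (\<lambda>(i, j). phi3_word s (concat (map (alpha_span n i j) w)))"

definition beta_rep :: "'a::comm_semiring_1 \<Rightarrow> nat \<Rightarrow> nat list \<Rightarrow> nat \<times> nat \<Rightarrow> 'a mat" where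
  "beta_rep s n w = (\<lambda>(i, j). phi3_word s (concat (map (beta_span n i j) w)))"

lemmas alpha_word_closed = concat_map_closed[OF alpha_span_closed]
lemmas beta_word_closed = concat_map_closed[OF beta_span_closed]

lemma phi_word_eq:
  "phi_word s n es w = diag_block_mat (map (alpha_rep s n w) es @ rev (map (beta_rep s n w) es))"
  by (simp add: phi_word_def alpha_rep_def beta_rep_def alpha_eq beta_eq phi3_baxt_class
      alpha_word_closed beta_word_closed)

lemma rep_UT: "alpha_rep s n w ij \<in> carrier (UT 15)" "beta_rep s n w ij \<in> carrier (UT 15)"
  unfolding alpha_rep_def beta_rep_def split_beta
  by (intro phi3_word_UT alpha_word_closed beta_word_closed)+

lemma rep_carrier: "alpha_rep s n w ij \<in> carrier_mat 15 15" "beta_rep s n w ij \<in> carrier_mat 15 15"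
  using rep_UT[of s n w ij] by simp_all

lemma rep_dim [simp]:
  "dim_row (alpha_rep s n w ij) = 15" "dim_col (alpha_rep s n w ij) = 15"
  "dim_row (beta_rep s n w ij) = 15" "dim_col (beta_rep s n w ij) = 15"
  using rep_carrier[of s n w ij] by simp_all

lemma rep_append:
  "alpha_rep s n (u @ v) ij = alpha_rep s n u ij * alpha_rep s n v ij"
  "beta_rep s n (u @ v) ij = beta_rep s n u ij * beta_rep s n v ij"
  by (simp_all add: alpha_rep_def beta_rep_def split_beta phi3_word_append alpha_word_closed
      beta_word_closed)

lemma rep_cong:
  assumes uv: "(u, v) \<in> baxt_cong n" and ij: "ij \<in> index_pairs n"
  shows "alpha_rep s n u ij = alpha_rep s n v ij" "beta_rep s n u ij = beta_rep s n v ij"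
proof -
  obtain i j where ij': "ij = (i, j)" by fastforce
  note ij = ij[unfolded ij']
  show "alpha_rep s n u ij = alpha_rep s n v ij"
  proof (rule alpha_span_cases[OF ij])
    fix p q g h :: nat
    assume "p < q" "1 \<le> g" "g < h" "h \<le> 3" and span: "alpha_span n i j = span_letter p q g h"
    then show ?thesis
      using phi3_word_cong[OF span_baxt_cong[OF uv]] unfolding alpha_rep_def ij' by simp
  qed
  show "beta_rep s n u ij = beta_rep s n v ij"
  proof (rule beta_span_cases[OF ij])
    fix p q g h :: nat
    assume "p < q" "1 \<le> g" "g < h" "h \<le> 3" and span: "beta_span n i j = span_letter p q g h"
    then show ?thesis
      using phi3_word_cong[OF span_baxt_cong[OF uv]] unfolding beta_rep_def ij' by simp
  qed
qed

lemma rep_sharp: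
  assumes "ij \<in> index_pairs n" "w \<in> lists {1..n}"
  shows "alpha_rep s n (word_sharp n w) ij = skew_transpose (beta_rep s n w ij)"
    and "beta_rep s n (word_sharp n w) ij = skew_transpose (alpha_rep s n w ij)"
proof -
  obtain i j where ij: "ij = (i, j)" "(i, j) \<in> index_pairs n" using assms(1) by (cases ij) simp
  show "alpha_rep s n (word_sharp n w) ij = skew_transpose (beta_rep s n w ij)"
    using concat_map_sharp[of n "alpha_span n i j" 3 "beta_span n i j", OF alpha_span_sharp[OF ij(2)] assms(2)]
    by (simp add: alpha_rep_def beta_rep_def ij(1) phi3_word_sharp beta_word_closed)
  show "beta_rep s n (word_sharp n w) ij = skew_transpose (alpha_rep s n w ij)"
    using concat_map_sharp[of n "beta_span n i j" 3 "alpha_span n i j", OF beta_span_sharp[OF ij(2)] assms(2)]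
    by (simp add: alpha_rep_def beta_rep_def ij(1) phi3_word_sharp alpha_word_closed)
qed

lemma phi_word_cong:
  assumes "set es = index_pairs n" and "(u, v) \<in> baxt_cong n"
  shows "phi_word s n es u = phi_word s n es v"
proof -
  have "map (alpha_rep s n u) es = map (alpha_rep s n v) es"
    "map (beta_rep s n u) es = map (beta_rep s n v) es"
    using rep_cong[OF assms(2)] assms(1) by auto
  then show ?thesis unfolding phi_word_eq by (simp only:)
qed

lemma phi_baxt_class:
  assumes es: "set es = index_pairs n" and w: "w \<in> lists {1..n}"
  shows "phi s n es (baxt_class n w) = phi_word s n es w"
proof -
  have "phi_word s n es ` baxt_class n w = (\<lambda>_. phi_word s n es w) ` baxt_class n w"
    by (rule image_cong[OF HOL.refl]) (simp add: in_baxt_class_iff phi_word_cong[OF es, of w])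
  also have "\<dots> = {phi_word s n es w}" using in_baxt_class_self[OF w] by blast
  finally have "phi_word s n es ` baxt_class n w = {phi_word s n es w}" .
  then show ?thesis by (simp add: phi_def)
qed

lemma phi_word_append: "phi_word s n es (u @ v) = phi_word s n es u * phi_word s n es v"
proof -
  let ?L = "\<lambda>w. map (alpha_rep s n w) es @ rev (map (beta_rep s n w) es)"
  have "diag_block_mat (?L u) * diag_block_mat (?L v) = diag_block_mat (map2 (*) (?L u) (?L v))"
    by (rule diag_block_mat_mult)
      (simp add: list_all2_append list_all2_map1 list_all2_map2 list_all2_rev list_all2_same rev_map)
  moreover have "map2 (*) (?L u) (?L v) = ?L (u @ v)"
    by (simp add: rev_map map2_map_map rep_append zip_append)
  ultimately show ?thesis by (simp add: phi_word_eq)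
qed

lemma phi_word_UT:
  assumes "distinct es" "set es = index_pairs n"
  shows "phi_word s n es w \<in> carrier (UT (30 * card (index_pairs n)))"
proof -
  let ?L = "map (alpha_rep s n w) es @ rev (map (beta_rep s n w) es)"
  have UT: "A \<in> carrier (UT 15)" if "A \<in> set ?L" for A using that rep_UT[of s n w] by auto
  have "diag_block_mat ?L \<in> carrier_mat (15 * length ?L) (15 * length ?L)"
    by (rule diag_block_mat_carrier) (use UT in simp)
  \<comment> \<open>Each index pair contributes two blocks of size 15.\<close>
  moreover have "15 * length ?L = 30 * card (index_pairs n)"
    using distinct_card[OF assms(1)] assms(2) by simp
  moreover have "upper_triangular (diag_block_mat ?L)"
  proof
    fix i j assume ij: "j < i" "i < dim_row (diag_block_mat ?L)"
    show "diag_block_mat ?L $$ (i, j) = 0"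
    proof (rule diag_block_upper_triangular[OF _ _ ij])
      show "Ball (set ?L) square_mat" using UT by auto
      fix A i j assume "A \<in> set ?L" "j < i" "i < dim_row A"
      then show "A $$ (i, j) = 0" using UT[of A] by (simp add: upper_triangularD)
    qed
  qed
  ultimately show ?thesis by (simp add: phi_word_eq)
qed

lemma phi_word_Nil:
  assumes "distinct es" "set es = index_pairs n"
  shows "phi_word s n es [] = 1\<^sub>m (30 * card (index_pairs n))"
proof -
  let ?L = "map (alpha_rep s n []) es @ rev (map (beta_rep s n []) es)"
  have "?L = map (\<lambda>A. 1\<^sub>m (dim_row A)) ?L"
    by (simp add: alpha_rep_def beta_rep_def split_beta phi3_word_def rev_map)
  then have "diag_block_mat ?L = 1\<^sub>m (sum_list (map dim_row ?L))"
    by (metis diag_block_one_mat)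
  also have "sum_list (map dim_row ?L) = 30 * card (index_pairs n)"
    using distinct_card[OF assms(1)] assms(2) by (simp add: o_def rev_map sum_list_triv)
  finally show ?thesis by (simp add: phi_word_eq)
qed

text \<open>The beta blocks are listed backwards, so reversing the list puts their skew transposes
  first, in the order of the enumeration. By \<open>rep_sharp\<close> these are the alpha blocks of
  the image word, and likewise with alpha and beta exchanged.\<close>

lemma phi_word_sharp:
  assumes "set es = index_pairs n" "w \<in> lists {1..n}"
  shows "phi_word s n es (word_sharp n w) = skew_transpose (phi_word s n es w)"
proof -
  have "skew_transpose (phi_word s n es w) = diag_block_mat
      (map (\<lambda>ij. skew_transpose (beta_rep s n w ij)) es @ rev (map (\<lambda>ij. skew_transpose (alpha_rep s n w ij)) es))"
    unfolding phi_word_eq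
    by (subst skew_transpose_diag_block_mat) (auto simp: rev_map o_def)
  also have "\<dots> = phi_word s n es (word_sharp n w)"
  proof -
    have "map (\<lambda>ij. skew_transpose (beta_rep s n w ij)) es = map (alpha_rep s n (word_sharp n w)) es"
      "map (\<lambda>ij. skew_transpose (alpha_rep s n w ij)) es = map (beta_rep s n (word_sharp n w)) es"
      using rep_sharp[OF _ assms(2), of _ s] assms(1) by simp_all
    then show ?thesis unfolding phi_word_eq by (simp only:)
  qed
  finally show ?thesis ..
qed

lemma phi_word_inject:
  fixes s :: "'a::comm_semiring_1"
  assumes inf: "\<And>i j::nat. s ^ i = s ^ j \<longleftrightarrow> i = j" and n: "2 \<le> n" and es: "set es = index_pairs n"
    and u: "u \<in> lists {1..n}" and v: "v \<in> lists {1..n}"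
    and eq: "phi_word s n es u = phi_word s n es v"
  shows "(u, v) \<in> baxt_cong n"
proof -
  let ?L = "\<lambda>w. map (alpha_rep s n w) es @ rev (map (beta_rep s n w) es)"
  have "?L u = ?L v"
    by (rule diag_block_mat_inject)
      (use eq in \<open>simp_all add: phi_word_eq list_all2_append list_all2_map1 list_all2_map2
        list_all2_same rev_map\<close>)
  then have rep: "alpha_rep s n u ij = alpha_rep s n v ij" "beta_rep s n u ij = beta_rep s n v ij"
    if "ij \<in> index_pairs n" for ij
    using that es by (auto simp: rev_map)
  \<comment> \<open>The letters \<open>g\<close> and \<open>h\<close> depend on which substitution
    spans \<open>(p, q)\<close>. Counts in the images are kept for the adjacent pairs below.\<close>
  have spans: "\<exists>g h. g < h \<and>
      count_list (concat (map (span_letter p q g h) u)) g = count_list (concat (map (span_letter p q g h) v)) g \<and>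
      count_list (concat (map (span_letter p q g h) u)) h = count_list (concat (map (span_letter p q g h) v)) h \<and>
      lcount p q u = lcount p q v \<and> rcount p q u = rcount p q v"
    if pq: "(p, q) \<in> index_pairs n" for p q
  proof -
    obtain g h where gh: "1 \<le> g" "g < h" "h \<le> 3"
      and "alpha_span n p q = span_letter p q g h \<or> beta_span n p q = span_letter p q g h"
      using index_pair_span[OF pq] by blast
    then have eq: "phi3_word s (concat (map (span_letter p q g h) u)) =
        phi3_word s (concat (map (span_letter p q g h) v))"
      using rep[OF pq] by (auto simp: alpha_rep_def beta_rep_def)
    have "span_letter p q g h k \<in> lists {1..3}" for k
      using gh by (intro span_letter_closed) auto
    then have "concat (map (span_letter p q g h) w) \<in> lists {1..3}" for w
      by (rule concat_map_closed)
    note inj = phi3_word_inject[OF inf this this eq gh]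
    have "p < q" using pq by (simp add: index_pairs_def)
    then show ?thesis
      using inj gh lcount_span[of p q g h] rcount_span[of p q g h] by (intro exI[of _ g] exI[of _ h]) simp
  qed
  have Suc_counts: "count_list u p = count_list v p \<and> count_list u (Suc p) = count_list v (Suc p)"
    if "1 \<le> p" "Suc p \<le> n" for p
    using spans[of p "Suc p"] that by (auto simp: index_pairs_def count_span_Suc)
  \<comment> \<open>A letter below \<open>n\<close> is the lower member of an adjacent pair;
    \<open>n\<close> itself is the upper member of \<open>(n - 1, n)\<close>, which exists as
    \<open>2 \<le> n\<close>.\<close>
  have "count_list u k = count_list v k" for k
  proof (cases "k \<in> {1..n}")
    case True
    then show ?thesis
      using Suc_counts[of k] Suc_counts[of "k - 1"] n by (cases "k < n") auto
  next
    case False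
    then have "k \<notin> set u" "k \<notin> set v" using u v by (auto simp: in_lists_conv_set)
    then show ?thesis by (simp add: count_list_0_iff)
  qed
  then have "mset u = mset v" by (intro multiset_eqI) (simp add: count_mset)
  moreover have "lcount p q u = lcount p q v \<and> rcount p q u = rcount p q v"
    if "1 \<le> p" "p < q" "q \<le> n" for p q
    using spans[of p q] that by (auto simp: index_pairs_def)
  ultimately show ?thesis
    using u by (simp add: baxt_cong_iff_same_invariants same_invariants_def)
qed

section \<open>Faithfulness of the representation\<close>

theorem theorem3p6:
  fixes s :: "'a::comm_semiring_1" and n :: nat and es :: "(nat \<times> nat) list"
  assumes idem: "\<And>a::'a. a + a = a"
    and infinite_order: "\<And>i j::nat. s ^ i = s ^ j \<longleftrightarrow> i = j"
    and n: "n \<ge> 4"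
    and enumeration: "distinct es" "set es = index_pairs n"
  shows "(\<forall>w \<in> lists {1..n}. phi s n es (baxt_class n w) = phi_word s n es w) \<and>
         involution_monoid_hom (baxt n) (baxt_sharp n)
           (UT (30 * card (index_pairs n))) skew_transpose (phi s n es) \<and>
         inj_on (phi s n es) (carrier (baxt n))"
proof (intro conjI ballI)
  fix w assume "w \<in> lists {1..n}"
  then show "phi s n es (baxt_class n w) = phi_word s n es w" by (rule phi_baxt_class[OF enumeration(2)])
next
  show "involution_monoid_hom (baxt n) (baxt_sharp n)
      (UT (30 * card (index_pairs n))) skew_transpose (phi s n es)"
    unfolding involution_monoid_hom_def
  proof (intro conjI baxt_involution_monoid UT_involution_monoid ballI)
    \<comment> \<open>Claims about classes pass to words by choosing representatives and applying
      \<open>phi_baxt_class\<close>.\<close>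
    show "phi s n es \<in> hom (baxt n) (UT (30 * card (index_pairs n)))"
    proof (rule homI)
      fix X assume "X \<in> carrier (baxt n)"
      then obtain u where u: "u \<in> lists {1..n}" "X = baxt_class n u" unfolding baxt_carrier by blast
      then show "phi s n es X \<in> carrier (UT (30 * card (index_pairs n)))"
        using phi_word_UT[OF enumeration, of s u] by (simp add: phi_baxt_class[OF enumeration(2)])
      fix Y assume "Y \<in> carrier (baxt n)"
      then obtain v where "v \<in> lists {1..n}" "Y = baxt_class n v" unfolding baxt_carrier by blast
      with u show "phi s n es (X \<otimes>\<^bsub>baxt n\<^esub> Y) =
          phi s n es X \<otimes>\<^bsub>UT (30 * card (index_pairs n))\<^esub> phi s n es Y"
        by (simp add: baxt_mult phi_baxt_class[OF enumeration(2)] phi_word_append)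
    qed
    show "phi s n es \<one>\<^bsub>baxt n\<^esub> = \<one>\<^bsub>UT (30 * card (index_pairs n))\<^esub>"
      using phi_word_Nil[OF enumeration, of s] by (simp add: baxt_one phi_baxt_class[OF enumeration(2)])
    fix X assume "X \<in> carrier (baxt n)"
    then obtain u where "u \<in> lists {1..n}" "X = baxt_class n u" unfolding baxt_carrier by blast
    then show "phi s n es (baxt_sharp n X) = skew_transpose (phi s n es X)"
      using word_sharp_closed[of u n] phi_word_sharp[OF enumeration(2), of u s]
      by (simp add: baxt_sharp_class phi_baxt_class[OF enumeration(2)])
  qed
next
  show "inj_on (phi s n es) (carrier (baxt n))"
  proof (rule inj_onI)
    fix X Y assume "X \<in> carrier (baxt n)" "Y \<in> carrier (baxt n)" and eq: "phi s n es X = phi s n es Y"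
    then obtain u v where uv: "u \<in> lists {1..n}" "v \<in> lists {1..n}"
      "X = baxt_class n u" "Y = baxt_class n v" unfolding baxt_carrier by blast
    then have "phi_word s n es u = phi_word s n es v" using eq by (simp add: phi_baxt_class[OF enumeration(2)])
    then have "(u, v) \<in> baxt_cong n"
      using phi_word_inject[OF infinite_order _ enumeration(2) uv(1,2)] n by simp
    then show "X = Y" using uv(3,4) by (simp add: baxt_class_eqI)
  qed
qed

end
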